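(* Let $A,B,X\in\mathcal{M}_n$ be such that $\begin{bmatrix} A & X^*\\ X & B\end{bmatrix}$ is PPT. Then for every $0\le t\le 1$, $$\lambda_j\left(2|X|-A\sharp_t B\right)\le\lambda_j\left(A\sharp_{1-t}B\right)$$ and $$\lambda_j\left(2|X^*|-A\sharp_{1-t}B\right)\le\lambda_j\left(A\sharp_t B\right)$$ for all $j=1,2,\ldots,n$.
   Context: $\mathcal{M}_n$ is the algebra of $n\times n$ complex matrices. $A\ge O$ means $A$ is positive semidefinite, $A>O$ means positive definite. $|X|=(X^*X)^{1/2}$. $\lambda_j(H)$ denotes the $j$-th largest eigenvalue (with multiplicity) of a Hermitian matrix $H$. A block matrix $\begin{bmatrix} A & X^*\\ X & B\end{bmatrix}$ is PPT (positive partial transpose) if both $\begin{bmatrix} A & X^*\\ X & B\end{bmatrix}$ and $\begin{bmatrix} A & X\\ X^* & B\end{bmatrix}$ are positive semidefinite. For $A,B>O$ and $0\le t\le 1$, $A\sharp_t B=A^{1/2}(A^{-1/2}BA^{-1/2})^tA^{1/2}$. For positive semidefinite $A,B$, $A\sharp_t B$ is understood as $\lim_{\varepsilon\to0^+}(A+\varepsilon I)\sharp_t(B+\varepsilon I)$. *)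

theory Defs
  imports
    Complex_Main
    "HOL-Computational_Algebra.Polynomial"
    "Jordan_Normal_Form.Schur_Decomposition"
begin

definition hermitian_mat :: "complex mat \<Rightarrow> bool" where
  "hermitian_mat A \<longleftrightarrow> square_mat A \<and> mat_adjoint A = A"

definition unitary_mat :: "complex mat \<Rightarrow> bool" where
  "unitary_mat U \<longleftrightarrow> square_mat U \<and> mat_adjoint U * U = 1\<^sub>m (dim_row U)"

(* The scalar (A v) \<bullet>c v is v^* A v; it is real for Hermitian A. *)
definition psd_mat :: "complex mat \<Rightarrow> bool" where
  "psd_mat A \<longleftrightarrow> hermitian_mat A \<and>
     (\<forall>v \<in> carrier_vec (dim_row A). Re ((A *\<^sub>v v) \<bullet>c v) \<ge> 0)"

definition pd_mat :: "complex mat \<Rightarrow> bool" where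
  "pd_mat A \<longleftrightarrow> hermitian_mat A \<and>
     (\<forall>v \<in> carrier_vec (dim_row A). v \<noteq> 0\<^sub>v (dim_row A) \<longrightarrow> Re ((A *\<^sub>v v) \<bullet>c v) > 0)"

definition ppt :: "complex mat \<Rightarrow> complex mat \<Rightarrow> complex mat \<Rightarrow> bool" where
  "ppt A B X \<longleftrightarrow>
     psd_mat (four_block_mat A (mat_adjoint X) X B) \<and>
     psd_mat (four_block_mat A X (mat_adjoint X) B)"

(* Functional calculus for Hermitian A: if A = U diag(d) U^* with U unitary and d real, then
   f(A) = U diag(f d) U^*; the result does not depend on the chosen diagonalization. *)
definition mat_fun :: "(real \<Rightarrow> real) \<Rightarrow> complex mat \<Rightarrow> complex mat" where
  "mat_fun f A = (THE B. \<exists>U d. U \<in> carrier_mat (dim_row A) (dim_row A) \<and> unitary_mat U \<and>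
     A = U * mat_diag (dim_row A) (\<lambda>i. complex_of_real (d i)) * mat_adjoint U \<and>
     B = U * mat_diag (dim_row A) (\<lambda>i. complex_of_real (f (d i))) * mat_adjoint U)"

(* Only used for psd A with s > 0 (where 0 powr s = 0 is the right value) and for pd A with any
   real s. *)
definition mat_powr :: "complex mat \<Rightarrow> real \<Rightarrow> complex mat" where
  "mat_powr A s = mat_fun (\<lambda>x. x powr s) A"

definition mat_abs :: "complex mat \<Rightarrow> complex mat" where
  "mat_abs X = mat_powr (mat_adjoint X * X) (1/2)"

definition gmean_pd :: "real \<Rightarrow> complex mat \<Rightarrow> complex mat \<Rightarrow> complex mat" where
  "gmean_pd t A B =
     mat_powr A (1/2) * mat_powr (mat_powr A (-1/2) * B * mat_powr A (-1/2)) t * mat_powr A (1/2)"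

(* Off the positive definite pairs, the limit for eps \<rightarrow> 0+ is taken entrywise, as the
   type of matrices carries no topology. *)
definition gmean :: "real \<Rightarrow> complex mat \<Rightarrow> complex mat \<Rightarrow> complex mat" where
  "gmean t A B =
     (if pd_mat A \<and> pd_mat B then gmean_pd t A B
      else Matrix.mat (dim_row A) (dim_row A) (\<lambda>ij. Lim (at_right (0::real)) (\<lambda>eps.
        gmean_pd t (A + complex_of_real eps \<cdot>\<^sub>m 1\<^sub>m (dim_row A))
                   (B + complex_of_real eps \<cdot>\<^sub>m 1\<^sub>m (dim_row A)) $$ ij)))"

(* eig_desc j H is the j-th largest eigenvalue of a Hermitian H for 1 \<le> j \<le> dim_row H,
   counted with multiplicity as a root of the characteristic polynomial; all eigenvalues of H
   are real, so Re loses nothing. *)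
definition eig_desc :: "nat \<Rightarrow> complex mat \<Rightarrow> real" where
  "eig_desc j H = rev (sorted_list_of_multiset (image_mset Re (proots (char_poly H)))) ! (j - 1)"

end

theory Submission
  imports Defs
begin

text \<open>
  For positive definite \<open>A\<close>, \<open>B\<close> there are an invertible \<open>S\<close> and a positive diagonal \<open>E\<close> with
  \<open>A = S* S\<close> and \<open>B = S* E^2 S\<close>, and then the mean of weight \<open>t\<close> is \<open>S* E^(2t) S\<close>. Let \<open>Y\<close> be
  defined by \<open>X = S* Y S\<close>. The PPT hypothesis says that \<open>E^(t-1) Y E^(-t)\<close> is a contraction for
  \<open>t = 0\<close> and \<open>t = 1\<close>. Interpolation gives it for \<open>0 \<le> t \<le> 1\<close>,
  which means that the block matrix with diagonal blocks the means of weight \<open>t\<close> and \<open>1 - t\<close>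
  and off-diagonal blocks \<open>X*\<close> and \<open>X\<close> is positive semidefinite. Testing it on vectors
  \<open>(v, -W v)\<close>, where \<open>X = W |X|\<close>, bounds \<open>2|X|\<close> minus the first mean by \<open>W* G W\<close>, where \<open>G\<close> is
  the second mean, and the eigenvalues are compared by a dimension count. The same interpolation
  shows that the means are monotone, so that the limit defining the mean of semidefinite matrices
  exists. The second inequality is the first one for \<open>X*\<close> and \<open>1 - t\<close>.
\<close>

section \<open>Adjoints and the spectral theorem\<close>

text \<open>The two halves of the PPT hypothesis serve different end points. After the congruence by
  \<open>S\<close>, the block matrix itself is positive semidefinite exactly when
  \<open>E^(-1) Y\<close> is a contraction, the case \<open>t = 0\<close>. Its partial transpose
  amounts to exchanging \<open>A\<close> and \<open>B\<close> and corresponds to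
  \<open>Y E^(-1)\<close>, the case \<open>t = 1\<close>. Two obstacles shape the rest. A limit
  written with \<open>Lim\<close> has no content until convergence is known, so in the semidefinite
  case monotonicity has to come before any inequality can be passed to the limit. And for singular
  \<open>X\<close> the factor \<open>W\<close> chosen here is a contraction but not unitary, so the
  eigenvalues of \<open>W* G W\<close> and \<open>G\<close> cannot be compared by unitary
  invariance; the comparison rests on \<open>G\<close> being positive semidefinite.\<close>

lemma mat_adjoint_carrier [simp]:
  "A \<in> carrier_mat m n \<Longrightarrow> mat_adjoint A \<in> carrier_mat n m"
  unfolding mat_adjoint_def by auto

lemma dim_mat_adjoint [simp]:
  "dim_row (mat_adjoint A) = dim_col A" "dim_col (mat_adjoint A) = dim_row A"
  unfolding mat_adjoint_def by auto

lemma index_mat_adjoint [simp]: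
  fixes A :: "complex mat"
  assumes "i < dim_col A" "j < dim_row A"
  shows "mat_adjoint A $$ (i, j) = cnj (A $$ (j, i))"
  using assms unfolding mat_adjoint_def mat_of_rows_def by auto

lemma mat_adjoint_adjoint [simp]: "mat_adjoint (mat_adjoint A) = (A :: complex mat)"
  by (rule eq_matI) auto

lemma mat_adjoint_mult:
  fixes A B :: "complex mat"
  assumes "A \<in> carrier_mat m k" "B \<in> carrier_mat k n"
  shows "mat_adjoint (A * B) = mat_adjoint B * mat_adjoint A"
  using assms by (intro eq_matI) (auto simp: scalar_prod_def mult.commute)

lemma mat_adjoint_add:
  fixes A B :: "complex mat"
  assumes "A \<in> carrier_mat m n" "B \<in> carrier_mat m n"
  shows "mat_adjoint (A + B) = mat_adjoint A + mat_adjoint B"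
  using assms by (intro eq_matI) auto

lemma mat_adjoint_minus:
  fixes A B :: "complex mat"
  assumes "A \<in> carrier_mat m n" "B \<in> carrier_mat m n"
  shows "mat_adjoint (A - B) = mat_adjoint A - mat_adjoint B"
  using assms by (intro eq_matI) auto

lemma mat_adjoint_smult:
  fixes A :: "complex mat"
  shows "mat_adjoint (c \<cdot>\<^sub>m A) = cnj c \<cdot>\<^sub>m mat_adjoint A"
  by (intro eq_matI) auto

lemma mat_adjoint_one [simp]: "mat_adjoint (1\<^sub>m n :: complex mat) = 1\<^sub>m n"
  by (intro eq_matI) auto

section \<open>Inner products and squared norms\<close>

lemma cscalar_prod_sum:
  fixes v w :: "complex vec"
  assumes "w \<in> carrier_vec n"
  shows "v \<bullet>c w = (\<Sum>i<n. v $ i * cnj (w $ i))"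
  using assms by (auto simp: scalar_prod_def lessThan_atLeast0 intro!: sum.cong)

lemma cscalar_prod_adjoint:
  fixes A :: "complex mat"
  assumes A: "A \<in> carrier_mat m n" and v: "v \<in> carrier_vec n" and w: "w \<in> carrier_vec m"
  shows "(A *\<^sub>v v) \<bullet>c w = v \<bullet>c (mat_adjoint A *\<^sub>v w)"
proof -
  have "(A *\<^sub>v v) \<bullet>c w = (\<Sum>i<m. \<Sum>j<n. A $$ (i, j) * v $ j * cnj (w $ i))"
    using A v by (subst cscalar_prod_sum[OF w])
      (auto simp: scalar_prod_def lessThan_atLeast0 sum_distrib_right intro!: sum.cong)
  also have "\<dots> = (\<Sum>j<n. \<Sum>i<m. A $$ (i, j) * v $ j * cnj (w $ i))"
    by (rule sum.swap)
  also have "\<dots> = v \<bullet>c (mat_adjoint A *\<^sub>v w)"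
    using A w by (subst cscalar_prod_sum[of _ n])
      (auto simp: scalar_prod_def lessThan_atLeast0 sum_distrib_left
        intro!: sum.cong mult_mat_vec_carrier[of _ _ m])
  finally show ?thesis .
qed

definition nsq :: "complex vec \<Rightarrow> real" where
  "nsq v = Re (v \<bullet>c v)"

lemma nsq_sum: "v \<in> carrier_vec n \<Longrightarrow> nsq v = (\<Sum>i<n. (cmod (v $ i))\<^sup>2)"
  by (simp add: nsq_def cscalar_prod_sum complex_mult_cnj cmod_power2 flip: of_real_sum)

lemma nsq_nonneg [simp]: "0 \<le> nsq v"
  by (subst nsq_sum[of _ "dim_vec v"]) (auto intro: sum_nonneg)

lemma nsq_eq_0: "v \<in> carrier_vec n \<Longrightarrow> nsq v = 0 \<Longrightarrow> v = 0\<^sub>v n"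
  by (subst (asm) nsq_sum[of _ n]) (auto simp: sum_nonneg_eq_0_iff)

lemma nsq_pos: "v \<in> carrier_vec n \<Longrightarrow> v \<noteq> 0\<^sub>v n \<Longrightarrow> 0 < nsq v"
  using nsq_eq_0 nsq_nonneg by (metis order_le_less)

lemma nsq_smult: "nsq (c \<cdot>\<^sub>v v) = (cmod c)\<^sup>2 * nsq v"
  by (subst (1 2) nsq_sum[of _ "dim_vec v"])
    (auto simp: norm_mult power_mult_distrib sum_distrib_left)

text \<open>Expands \<open>|sqrt s x - y / sqrt s|^2 >= 0\<close> coordinatewise. The free weight
  \<open>s\<close> makes this a substitute for Cauchy-Schwarz that stays linear in the squared
  norms: \<open>nsq_adjoint_bound\<close> takes \<open>s = 1 / c\<close> and
  \<open>ppt_gmean_pd\<close> takes \<open>s = 1\<close>.\<close>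

lemma Re_cscalar_prod_le:
  fixes v w :: "complex vec"
  assumes "v \<in> carrier_vec n" "w \<in> carrier_vec n" "s > 0"
  shows "2 * Re (v \<bullet>c w) \<le> s * nsq v + nsq w / s"
proof -
  have *: "2 * Re (x * cnj y) \<le> s * (cmod x)\<^sup>2 + (cmod y)\<^sup>2 / s" for x y :: complex
  proof -
    have "0 \<le> (sqrt s * Re x - Re y / sqrt s)\<^sup>2 + (sqrt s * Im x - Im y / sqrt s)\<^sup>2"
      by simp
    also have "\<dots> = s * (cmod x)\<^sup>2 + (cmod y)\<^sup>2 / s - 2 * Re (x * cnj y)"
      using \<open>s > 0\<close>
      by (simp add: power2_diff power_mult_distrib power_divide cmod_power2) (simp add: field_simps)
    finally show ?thesis by simp
  qed
  have "2 * Re (v \<bullet>c w) = (\<Sum>i<n. 2 * Re (v $ i * cnj (w $ i)))"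
    using assms by (simp add: cscalar_prod_sum sum_distrib_left)
  also have "\<dots> \<le> (\<Sum>i<n. s * (cmod (v $ i))\<^sup>2 + (cmod (w $ i))\<^sup>2 / s)"
    by (intro sum_mono *)
  also have "\<dots> = s * nsq v + nsq w / s"
    using assms by (simp add: nsq_sum sum.distrib sum_distrib_left sum_divide_distrib)
  finally show ?thesis .
qed

lemma cscalar_prod_commute:
  fixes v w :: "complex vec"
  assumes "v \<in> carrier_vec n" "w \<in> carrier_vec n"
  shows "w \<bullet>c v = cnj (v \<bullet>c w)"
  using assms by (simp add: cscalar_prod_sum mult.commute)

text \<open>Gram-Schmidt leaves the head of the basis alone and normalization only rescales it, so
  the first column is a multiple of \<open>v\<close>. This prepares the deflation in
  \<open>hermitian_spectral\<close>.\<close>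

lemma exists_unitary_col:
  fixes v :: "complex vec"
  assumes v: "v \<in> carrier_vec (Suc m)" and v0: "v \<noteq> 0\<^sub>v (Suc m)"
  shows "\<exists>W c. W \<in> carrier_mat (Suc m) (Suc m) \<and> mat_adjoint W * W = 1\<^sub>m (Suc m) \<and>
    col W 0 = c \<cdot>\<^sub>v v"
proof -
  define n where "n = Suc m"
  note v = v[folded n_def] and v0 = v0[folded n_def]
  interpret cof_vec_space n "TYPE(complex)" .
  define b where "b = basis_completion v"
  define ws where "ws = gram_schmidt n b"
  from basis_completion[OF v v0, folded b_def]
  have dist_b: "distinct b" and indep: "\<not> lin_dep (set b)" and b: "set b \<subseteq> carrier_vec n"
    and hdb: "hd b = v" and len_b: "length b = n" by auto
  from hdb len_b n_def obtain vs where bv: "b = v # vs" by (cases b) auto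
  from gram_schmidt_result[OF b dist_b indep refl, folded ws_def]
  have ws: "set ws \<subseteq> carrier_vec n" "corthogonal ws" "length ws = n"
    by (auto simp: len_b)
  from gram_schmidt_hd[OF v, of vs, folded bv] have hdws: "hd ws = v"
    unfolding ws_def .
  have wsi: "ws ! i \<in> carrier_vec n" if "i < n" for i
    using ws that by auto
  have pos: "nsq (ws ! i) > 0" if "i < n" for i
    using corthogonalD[OF ws(2), of i i] ws(3) that wsi[OF that]
    by (intro nsq_pos[of _ n]) auto
  define c where "c i = complex_of_real (1 / sqrt (nsq (ws ! i)))" for i
  define W where "W = mat_of_cols n (map (\<lambda>i. c i \<cdot>\<^sub>v ws ! i) [0..<n])"
  have W: "W \<in> carrier_mat n n"
    unfolding W_def by auto
  have colW: "col W i = c i \<cdot>\<^sub>v ws ! i" if "i < n" for i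
    using that wsi[OF that] unfolding W_def by (subst col_mat_of_cols) auto
  have nsq_eq: "(ws ! i) \<bullet>c (ws ! i) = complex_of_real (nsq (ws ! i))" if "i < n" for i
    using wsi[OF that]
    by (simp add: cscalar_prod_sum nsq_sum complex_mult_cnj flip: cmod_power2 )
  have prod: "(mat_adjoint W * W) $$ (i, j) = (if i = j then 1 else 0)" if i: "i < n"
    and j: "j < n" for i j
  proof -
    have "(mat_adjoint W * W) $$ (i, j) = col W j \<bullet>c col W i"
      using W i j unfolding cscalar_prod_sum[OF col_carrier_vec[OF i W]]
      by (auto simp: scalar_prod_def lessThan_atLeast0 mult.commute intro!: sum.cong)
    also have "\<dots> = c j * c i * (ws ! j \<bullet>c ws ! i)"
      using wsi[OF i] wsi[OF j] i j
      by (simp add: colW cscalar_prod_sum[of _ n] sum_distrib_left c_def field_simps)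
    also have "\<dots> = (if i = j then 1 else 0)"
    proof (cases "i = j")
      case True
      have "c j * c j * complex_of_real (nsq (ws ! j)) = of_real (1 / sqrt (nsq (ws ! j)) * (1 / sqrt (nsq (ws ! j))) * nsq (ws ! j))"
        by (simp only: c_def of_real_mult)
      also have "1 / sqrt (nsq (ws ! j)) * (1 / sqrt (nsq (ws ! j))) * nsq (ws ! j) = 1"
        using pos[OF j] by (simp add: field_simps)
      finally show ?thesis using True nsq_eq[OF j] by simp
    next
      case False
      then show ?thesis using corthogonalD[OF ws(2), of j i] ws(3) i j by auto
    qed
    finally show ?thesis .
  qed
  have "mat_adjoint W * W = 1\<^sub>m n"
    using W prod by (intro eq_matI) auto
  moreover have "col W 0 = c 0 \<cdot>\<^sub>v v"
    using colW[of 0] hdws ws(3) n_def by (cases ws) auto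
  ultimately show ?thesis using W unfolding n_def by blast
qed

section \<open>Real diagonal matrices\<close>

definition rdiag :: "nat \<Rightarrow> (nat \<Rightarrow> real) \<Rightarrow> complex mat" where
  "rdiag n d = mat_diag n (\<lambda>i. complex_of_real (d i))"

lemma rdiag_carrier [simp]: "rdiag n d \<in> carrier_mat n n"
  by (simp add: rdiag_def)

lemma dim_rdiag [simp]: "dim_row (rdiag n d) = n" "dim_col (rdiag n d) = n"
  by (simp_all add: rdiag_def mat_diag_def)

lemma index_rdiag [simp]:
  "i < n \<Longrightarrow> j < n \<Longrightarrow> rdiag n d $$ (i, j) = (if i = j then complex_of_real (d i) else 0)"
  by (simp add: rdiag_def mat_diag_def)

lemma mat_adjoint_rdiag [simp]: "mat_adjoint (rdiag n d) = rdiag n d"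
  by (rule eq_matI) auto

lemma row_rdiag_scalar_prod [simp]:
  "v \<in> carrier_vec n \<Longrightarrow> i < n \<Longrightarrow> row (rdiag n d) i \<bullet> v = complex_of_real (d i) * v $ i"
  by (auto simp: scalar_prod_def if_distrib if_distribR sum.delta cong: if_cong)

lemma scalar_prod_col_rdiag [simp]:
  "v \<in> carrier_vec n \<Longrightarrow> i < n \<Longrightarrow> v \<bullet> col (rdiag n d) i = v $ i * complex_of_real (d i)"
  by (auto simp: scalar_prod_def if_distrib if_distribR sum.delta cong: if_cong)

lemma rdiag_cong: "(\<And>i. i < n \<Longrightarrow> f i = g i) \<Longrightarrow> rdiag n f = rdiag n g"
  by (intro eq_matI) auto

lemma rdiag_mult: "rdiag n f * rdiag n g = rdiag n (\<lambda>i. f i * g i)"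
  by (simp add: rdiag_def)

lemma rdiag_one: "(\<And>i. i < n \<Longrightarrow> f i = 1) \<Longrightarrow> rdiag n f = 1\<^sub>m n"
  by (intro eq_matI) auto

lemma unitary_mat_right_inverse:
  fixes U :: "complex mat"
  assumes "U \<in> carrier_mat n n" "mat_adjoint U * U = 1\<^sub>m n"
  shows "U * mat_adjoint U = 1\<^sub>m n"
  by (rule mat_mult_left_right_inverse[OF _ assms(1) assms(2)]) (use assms in auto)

lemma mat_adjoint_four_block:
  fixes A B C D :: "complex mat"
  assumes "A \<in> carrier_mat a a" "B \<in> carrier_mat a d" "C \<in> carrier_mat d a" "D \<in> carrier_mat d d"
  shows "mat_adjoint (four_block_mat A B C D) =
    four_block_mat (mat_adjoint A) (mat_adjoint C) (mat_adjoint B) (mat_adjoint D)"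
  using assms by (intro eq_matI) (auto simp: not_less)

text \<open>Deflation: with an eigenvector as first column of a unitary \<open>W\<close>, the first
  column of \<open>W* A W\<close> is a multiple of the first unit vector. Symmetry clears the first
  row as well, and the induction hypothesis diagonalizes the remaining block.\<close>

theorem hermitian_spectral:
  fixes A :: "complex mat"
  assumes "A \<in> carrier_mat n n" "mat_adjoint A = A"
  shows "\<exists>U d. U \<in> carrier_mat n n \<and> mat_adjoint U * U = 1\<^sub>m n \<and> A = U * rdiag n d * mat_adjoint U"
  using assms
proof (induction n arbitrary: A)
  case 0
  then show ?case
    by (intro exI[of _ "1\<^sub>m 0"] exI) auto
next
  case (Suc m)
  define n where "n = Suc m"
  note A = Suc.prems(1)[folded n_def] and H = Suc.prems(2)
  have "degree (char_poly A) = Suc m"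
    using degree_monic_char_poly[OF A] n_def by simp
  then have "\<not> constant (poly (char_poly A))"
    by (simp add: constant_degree)
  then obtain e where "poly (char_poly A) e = 0"
    using fundamental_theorem_of_algebra by blast
  then have "eigenvalue A e"
    using eigenvalue_root_char_poly[OF A] by simp
  then obtain v where v: "v \<in> carrier_vec n" "v \<noteq> 0\<^sub>v n" and Av: "A *\<^sub>v v = e \<cdot>\<^sub>v v"
    unfolding eigenvalue_def eigenvector_def using A by auto
  obtain W c where W: "W \<in> carrier_mat n n" and WW: "mat_adjoint W * W = 1\<^sub>m n"
    and col: "col W 0 = c \<cdot>\<^sub>v v"
    using exists_unitary_col[of v m] v unfolding n_def by blast
  have WW': "W * mat_adjoint W = 1\<^sub>m n"
    by (rule unitary_mat_right_inverse[OF W WW])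
  define A' where "A' = mat_adjoint W * A * W"
  have A': "A' \<in> carrier_mat n n" unfolding A'_def using W A by auto
  have H': "mat_adjoint A' = A'"
    unfolding A'_def using W A H
    by (simp add: mat_adjoint_mult[of _ n n _ n] assoc_mult_mat[of _ n n _ n _ n] mult_carrier_mat[of _ n n _ n])
  have n0: "0 < n" by (simp add: n_def)
  have col0: "col A' 0 = e \<cdot>\<^sub>v unit_vec n 0"
  proof -
    have "col A' 0 = mat_adjoint W *\<^sub>v (A *\<^sub>v col W 0)"
      unfolding A'_def using W A n0
      by (subst col_mult2[of _ n n _ n]) (auto simp: assoc_mult_mat_vec[of _ n n _ n])
    also have "A *\<^sub>v col W 0 = e \<cdot>\<^sub>v col W 0"
      unfolding col using v A
        by (simp add: mult_mat_vec[of _ n n] Av smult_smult_assoc mult.commute)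
    also have "mat_adjoint W *\<^sub>v (e \<cdot>\<^sub>v col W 0) = e \<cdot>\<^sub>v (mat_adjoint W *\<^sub>v col W 0)"
      using W n0 by (intro mult_mat_vec[of _ n n]) auto
    also have "mat_adjoint W *\<^sub>v col W 0 = col (mat_adjoint W * W) 0"
      using W n0 by (subst col_mult2[of _ n n _ n]) auto
    finally show ?thesis using WW n0 by simp
  qed
  have Ai0: "A' $$ (i, 0) = (if i = 0 then e else 0)" if "i < n" for i
    using arg_cong[OF col0, of "\<lambda>v. v $ i"] that A' n0 by auto
  have A0i: "A' $$ (0, i) = (if i = 0 then cnj e else 0)" if "i < n" for i
    using arg_cong[OF H', of "\<lambda>M. M $$ (0, i)"] that A' n0 Ai0[OF that] by (auto split: if_splits)
  \<comment> \<open>Entry \<open>(0, 0)\<close> equals \<open>e\<close> by the column computation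
    and \<open>cnj e\<close> by symmetry.\<close>
  have e: "e = complex_of_real (Re e)"
    using A0i[OF n0] Ai0[OF n0] by (simp add: complex_eq_iff)
  have e': "cnj e = e" by (subst (1 2) e) simp
  define A3 where "A3 = mat m m (\<lambda>(i, j). A' $$ (Suc i, Suc j))"
  have A3: "A3 \<in> carrier_mat m m" unfolding A3_def by simp
  have "mat_adjoint A3 = A3"
  proof (rule eq_matI)
    fix i j assume ij: "i < dim_row A3" "j < dim_col A3"
    then have "mat_adjoint A' $$ (Suc i, Suc j) = A' $$ (Suc i, Suc j)"
      using H' by simp
    then show "mat_adjoint A3 $$ (i, j) = A3 $$ (i, j)"
      using ij A' by (simp add: A3_def n_def)
  qed (auto simp: A3_def)
  from Suc.IH[OF A3 this] obtain U3 d where U3: "U3 \<in> carrier_mat m m"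
    and UU3: "mat_adjoint U3 * U3 = 1\<^sub>m m" and A3eq: "A3 = U3 * rdiag m d * mat_adjoint U3"
    by blast
  define z where "z = (0\<^sub>m 1 m :: complex mat)"
  define z' where "z' = (0\<^sub>m m 1 :: complex mat)"
  have zc: "z \<in> carrier_mat 1 m" "z' \<in> carrier_mat m 1" by (auto simp: z_def z'_def)
  have adjz: "mat_adjoint z = z'" "mat_adjoint z' = z"
    unfolding z_def z'_def by (auto intro!: eq_matI)
  define V where "V = four_block_mat (1\<^sub>m 1) z z' U3"
  have V: "V \<in> carrier_mat n n"
    unfolding V_def n_def using four_block_carrier_mat[OF one_carrier_mat[of 1] U3] by simp
  have adjV: "mat_adjoint V = four_block_mat (1\<^sub>m 1) z z' (mat_adjoint U3)"
    unfolding V_def using mat_adjoint_four_block[OF one_carrier_mat[of 1] zc U3] adjz by simp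
  have VV: "mat_adjoint V * V = 1\<^sub>m n"
    unfolding adjV unfolding V_def n_def using U3 UU3
    by (subst mult_four_block_mat[OF one_carrier_mat zc _ one_carrier_mat zc])
       (auto simp: z_def z'_def  simp del: One_nat_def simp flip: plus_1_eq_Suc)
  define a where "a = mat 1 1 (\<lambda>_. e)"
  have ac: "a \<in> carrier_mat 1 1" by (simp add: a_def)
  have A'eq: "A' = four_block_mat a z z' A3"
    using A' A3 by (intro eq_matI)
      (auto simp: a_def z_def z'_def A3_def n_def Ai0 A0i[unfolded n_def] Ai0[unfolded n_def] e' less_Suc_eq_0_disj)
  define f where "f i = (if i = 0 then Re e else d (i - 1))" for i
  have "rdiag n f = four_block_mat a z z' (rdiag m d)"
    using e by (intro eq_matI) (auto simp: a_def z_def z'_def n_def f_def less_Suc_eq_0_disj)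
  moreover have "V * four_block_mat a z z' (rdiag m d) = four_block_mat a z z' (U3 * rdiag m d)"
    unfolding V_def using U3 ac
    by (subst mult_four_block_mat[OF one_carrier_mat zc _ ac zc])
      (auto simp: z_def z'_def left_mult_zero_mat[of _ m m] mult_carrier_mat[of _ m m _ m])
  moreover have "four_block_mat a z z' (U3 * rdiag m d) * mat_adjoint V = four_block_mat a z z' (U3 * rdiag m d * mat_adjoint U3)"
    unfolding adjV using U3 ac
    by (subst mult_four_block_mat[OF ac zc _ one_carrier_mat zc])
      (auto simp: z_def z'_def right_mult_zero_mat[of _ m m] mult_carrier_mat[of _ m m _ m])
  ultimately have A'V: "A' = V * rdiag n f * mat_adjoint V"
    using A3eq A'eq by simp
  have "A = (W * mat_adjoint W) * A * (W * mat_adjoint W)"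
    unfolding WW' using A by simp
  also have "\<dots> = W * A' * mat_adjoint W"
    unfolding A'_def using W A
    by (simp add: assoc_mult_mat[of _ n n _ n _ n] mult_carrier_mat[of _ n n _ n])
  also have "\<dots> = (W * V) * rdiag n f * mat_adjoint (W * V)"
    unfolding A'V using W V
    by (simp add: mat_adjoint_mult[of _ n n _ n] assoc_mult_mat[of _ n n _ n _ n] mult_carrier_mat[of _ n n _ n])
  finally have "A = (W * V) * rdiag n f * mat_adjoint (W * V)" .
  moreover have "mat_adjoint (W * V) * (W * V) = mat_adjoint V * (mat_adjoint W * W) * V"
    using W V
    by (simp add: mat_adjoint_mult[of _ n n _ n] assoc_mult_mat[of _ n n _ n _ n] mult_carrier_mat[of _ n n _ n])
  then have "mat_adjoint (W * V) * (W * V) = 1\<^sub>m n"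
    using V by (simp add: WW VV right_mult_one_mat[of _ n n])
  moreover have "W * V \<in> carrier_mat n n" using W V by simp
  ultimately show ?case unfolding n_def by blast
qed

section \<open>Quadratic forms and functional calculus\<close>

definition qform :: "complex mat \<Rightarrow> complex vec \<Rightarrow> real" where
  "qform A v = Re ((A *\<^sub>v v) \<bullet>c v)"

lemma smult_mat_mult_vec:
  fixes A :: "complex mat"
  shows "A \<in> carrier_mat m n \<Longrightarrow> v \<in> carrier_vec n \<Longrightarrow> (c \<cdot>\<^sub>m A) *\<^sub>v v = c \<cdot>\<^sub>v (A *\<^sub>v v)"
  by (intro eq_vecI) (auto simp: scalar_prod_def sum_distrib_left mult.assoc)

lemma mult_mat_zero_vec:
  fixes A :: "complex mat"
  shows "A \<in> carrier_mat m n \<Longrightarrow> A *\<^sub>v 0\<^sub>v n = 0\<^sub>v m"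
  by (intro eq_vecI) auto

text \<open>The bound is uniform in \<open>t\<close>, which lets \<open>interp_bounded\<close>
  choose one constant for the whole unit interval.\<close>

lemma powr_le_one_plus:
  fixes x :: real
  assumes "x > 0" "0 \<le> t" "t \<le> 1"
  shows "x powr t \<le> 1 + x"
proof (cases "x \<le> 1")
  case True
  then have "x powr t \<le> 1" using assms by (intro powr_le1) auto
  then show ?thesis using assms by simp
next
  case False
  then have "x powr t \<le> x powr 1" using assms by (intro powr_mono) auto
  then show ?thesis using assms by simp
qed

text \<open>The limit is the infimum over the positive arguments. For the quadratic forms of the
  regularized means this gives convergence without a formula for the limit.\<close>

lemma mono_tendsto_at_right:
  fixes f :: "real \<Rightarrow> real"
  assumes mono: "\<And>x y. 0 < x \<Longrightarrow> x \<le> y \<Longrightarrow> f x \<le> f y" and nonneg: "\<And>x. 0 < x \<Longrightarrow> 0 \<le> f x"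
  shows "\<exists>l. (f \<longlongrightarrow> l) (at_right 0)"
proof (rule exI, rule order_tendstoI)
  define l where "l = Inf (f ` {0<..})"
  have bdd: "bdd_below (f ` {0<..})" using nonneg by (intro bdd_belowI[of _ 0]) auto
  have le: "l \<le> f x" if "0 < x" for x
    unfolding l_def using that by (intro cInf_lower bdd) auto
  show "\<forall>\<^sub>F x in at_right 0. a < f x" if "a < Inf (f ` {0<..})" for a
    using le that unfolding l_def eventually_at_right_field by (intro exI[of _ 1])
      (auto intro: less_le_trans)
  show "\<forall>\<^sub>F x in at_right 0. f x < a" if a: "Inf (f ` {0<..}) < a" for a
  proof -
    obtain y where y: "0 < y" "f y < a"
      using cInf_lessD[OF _ a] by auto
    then show ?thesis
      unfolding eventually_at_right_field
      using mono[of _ y] by (intro exI[of _ y]) (auto intro: le_less_trans[of _ "f y"])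
  qed
qed

text \<open>Positions in the sorted list become counts over the unsorted one, which is what a
  dimension count over the indices of an eigenbasis needs. Sorting only permutes the entries, so the
  counts agree. Here \<open>j\<close> starts at 0, and the first \<open>j + 1\<close> entries of the
  decreasing list give the strict bound.\<close>

lemma rev_sort_nth_ge:
  fixes xs :: "real list"
  assumes "j < length xs"
  shows "j < card {i. i < length xs \<and> rev (sort xs) ! j \<le> xs ! i}"
    and "rev (sort xs) ! j < c \<Longrightarrow> card {i. i < length xs \<and> c \<le> xs ! i} \<le> j"
proof -
  define ys where "ys = rev (sort xs)"
  have len: "length ys = length xs" by (simp add: ys_def)
  have count: "card {i. i < length xs \<and> P (xs ! i)} = card {i. i < length ys \<and> P (ys ! i)}" for P
  proof -
    have "mset (filter P xs) = mset (filter P ys)" by (simp add: ys_def mset_filter)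
    then have "length (filter P xs) = length (filter P ys)" by (rule mset_eq_length)
    then show ?thesis by (simp add: length_filter_conv_card)
  qed
  have mono: "ys ! k \<le> ys ! i" if "i \<le> k" "k < length ys" for i k
    using sorted_rev_nth_mono[of ys i k] that by (simp add: ys_def)
  have "{..j} \<subseteq> {i. i < length ys \<and> ys ! j \<le> ys ! i}"
    using mono[of _ j] assms len by auto
  from card_mono[OF _ this]
  show "j < card {i. i < length xs \<and> rev (sort xs) ! j \<le> xs ! i}"
    unfolding count ys_def[symmetric] by simp
  assume c: "rev (sort xs) ! j < c"
  have "{i. i < length ys \<and> c \<le> ys ! i} \<subseteq> {..<j}"
  proof
    fix i assume "i \<in> {i. i < length ys \<and> c \<le> ys ! i}"
    then show "i \<in> {..<j}"
      using mono[of j i] c by (fastforce simp: ys_def[symmetric] not_less)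
  qed
  from card_mono[OF _ this]
  show "card {i. i < length xs \<and> c \<le> xs ! i} \<le> j"
    unfolding count by simp
qed

context
  fixes n :: nat
begin

lemma square_mult_carrier [simp]:
  "A \<in> carrier_mat n n \<Longrightarrow> B \<in> carrier_mat n n \<Longrightarrow> A * B \<in> carrier_mat n n"
  by simp

lemma square_mult_vec_carrier [simp]:
  "A \<in> carrier_mat n n \<Longrightarrow> v \<in> carrier_vec n \<Longrightarrow> A *\<^sub>v v \<in> carrier_vec n"
  by simp

lemmas square_assoc = assoc_mult_mat[of _ n n _ n _ n]
lemmas square_assoc_vec = assoc_mult_mat_vec[of _ n n _ n]
lemmas square_adjoint_mult = mat_adjoint_mult[of _ n n _ n]

lemma square_cancel:
  fixes P Q X :: "complex mat"
  assumes "P * Q = 1\<^sub>m n" "P \<in> carrier_mat n n" "Q \<in> carrier_mat n n" "X \<in> carrier_mat n n"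
  shows "P * (Q * X) = X"
  using assms by (simp flip: square_assoc)

lemma square_cancel_vec:
  fixes P Q :: "complex mat"
  assumes "P * Q = 1\<^sub>m n" "P \<in> carrier_mat n n" "Q \<in> carrier_mat n n" "v \<in> carrier_vec n"
  shows "P *\<^sub>v (Q *\<^sub>v v) = v"
  using assms by (simp flip: square_assoc_vec)

text \<open>\<open>W = V* U\<close> intertwines the two diagonal matrices, so its entry
  \<open>(i, j)\<close> vanishes unless \<open>d j = e i\<close>. Hence \<open>W\<close> also
  intertwines their images under \<open>f\<close>. This is what makes the definite description in
  \<open>mat_fun\<close> well defined.\<close>

lemma spectral_calculus_unique:
  fixes U V :: "complex mat" and d e f :: "_ \<Rightarrow> real"
  assumes U: "U \<in> carrier_mat n n" "mat_adjoint U * U = 1\<^sub>m n"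
    and V: "V \<in> carrier_mat n n" "mat_adjoint V * V = 1\<^sub>m n"
    and eq: "U * rdiag n d * mat_adjoint U = V * rdiag n e * mat_adjoint V"
  shows "U * rdiag n (\<lambda>i. f (d i)) * mat_adjoint U = V * rdiag n (\<lambda>i. f (e i)) * mat_adjoint V"
proof -
  note UU = unitary_mat_right_inverse[OF U] and VV = unitary_mat_right_inverse[OF V]
  define W where "W = mat_adjoint V * U"
  have W: "W \<in> carrier_mat n n" using U V by (simp add: W_def)
  have "W * rdiag n d = mat_adjoint V * (U * rdiag n d * mat_adjoint U) * U"
    using U V by (simp add: W_def square_assoc right_mult_one_mat[of _ n n])
  also have "\<dots> = rdiag n e * W"
    unfolding eq using U V by (simp add: W_def square_assoc square_cancel[OF V(2)])
  finally have WW: "W * rdiag n d = rdiag n e * W" .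
  have "W $$ (i, j) * complex_of_real (d j) = complex_of_real (e i) * W $$ (i, j)"
    if "i < n" "j < n" for i j
    using arg_cong[OF WW, of "\<lambda>M. M $$ (i, j)"] W that
    by simp
  then have "W $$ (i, j) = 0 \<or> d j = e i" if "i < n" "j < n" for i j
    using that by (metis mult.commute mult_cancel_left of_real_eq_iff)
  then have "W $$ (i, j) * complex_of_real (f (d j)) = complex_of_real (f (e i)) * W $$ (i, j)"
    if "i < n" "j < n" for i j
    using that by (metis mult.commute mult_zero_left)
  then have fW: "W * rdiag n (\<lambda>i. f (d i)) = rdiag n (\<lambda>i. f (e i)) * W"
    using W by (auto intro!: eq_matI)
  have "U * rdiag n (\<lambda>i. f (d i)) * mat_adjoint U = V * (W * rdiag n (\<lambda>i. f (d i))) * mat_adjoint U"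
    using U V by (simp add: W_def square_assoc square_cancel[OF VV])
  also have "\<dots> = V * rdiag n (\<lambda>i. f (e i)) * mat_adjoint V"
    unfolding fW using U V
      by (simp add: W_def square_assoc square_cancel[OF UU] UU right_mult_one_mat[of _ n n])
  finally show ?thesis .
qed

lemma mat_fun_eq:
  assumes U: "U \<in> carrier_mat n n" "mat_adjoint U * U = 1\<^sub>m n"
    and A: "A = U * rdiag n d * mat_adjoint U"
  shows "mat_fun f A = U * rdiag n (\<lambda>i. f (d i)) * mat_adjoint U"
proof -
  have dim: "dim_row A = n" using A U by simp
  show ?thesis
    unfolding mat_fun_def dim rdiag_def[symmetric]
  proof (rule the_equality)
    show "\<exists>V e. V \<in> carrier_mat n n \<and> unitary_mat V \<and> A = V * rdiag n e * mat_adjoint V \<and>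
        U * rdiag n (\<lambda>i. f (d i)) * mat_adjoint U = V * rdiag n (\<lambda>i. f (e i)) * mat_adjoint V"
      using U A by (intro exI[of _ U] exI[of _ d]) (auto simp: unitary_mat_def)
  next
    fix B
    assume "\<exists>V e. V \<in> carrier_mat n n \<and> unitary_mat V \<and> A = V * rdiag n e * mat_adjoint V \<and>
        B = V * rdiag n (\<lambda>i. f (e i)) * mat_adjoint V"
    then obtain V e where V: "V \<in> carrier_mat n n" "unitary_mat V"
      "A = V * rdiag n e * mat_adjoint V" "B = V * rdiag n (\<lambda>i. f (e i)) * mat_adjoint V"
      by blast
    then have "mat_adjoint V * V = 1\<^sub>m n" by (auto simp: unitary_mat_def)
    from spectral_calculus_unique[OF U V(1) this, of d e f] show "B = U * rdiag n (\<lambda>i. f (d i)) * mat_adjoint U"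
      using A V by simp
  qed
qed

section \<open>Quadratic forms under congruence and diagonalization\<close>

lemma qform_congruence:
  assumes "S \<in> carrier_mat n n" "M \<in> carrier_mat n n" "v \<in> carrier_vec n"
  shows "qform (mat_adjoint S * M * S) v = qform M (S *\<^sub>v v)"
  using assms
  by (simp add: qform_def square_assoc square_assoc_vec cscalar_prod_adjoint[of _ n n])

lemma qform_rdiag:
  "v \<in> carrier_vec n \<Longrightarrow> qform (rdiag n d) v = (\<Sum>i<n. d i * (cmod (v $ i))\<^sup>2)"
  by (simp add: qform_def cscalar_prod_sum[of _ n] complex_mult_cnj cmod_power2 mult.assoc flip: of_real_add of_real_mult of_real_sum)

lemma nsq_rdiag:
  "v \<in> carrier_vec n \<Longrightarrow> nsq (rdiag n d *\<^sub>v v) = (\<Sum>i<n. (d i)\<^sup>2 * (cmod (v $ i))\<^sup>2)"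
  by (simp add: nsq_sum[of _ n] norm_mult power_mult_distrib)

lemma qform_adjoint_mult:
  "M \<in> carrier_mat n n \<Longrightarrow> v \<in> carrier_vec n \<Longrightarrow> qform (mat_adjoint M * M) v = nsq (M *\<^sub>v v)"
  by (simp add: qform_def nsq_def square_assoc_vec cscalar_prod_adjoint[of _ n n])

lemma nsq_unitary:
  "M \<in> carrier_mat n n \<Longrightarrow> mat_adjoint M * M = 1\<^sub>m n \<Longrightarrow> v \<in> carrier_vec n \<Longrightarrow> nsq (M *\<^sub>v v) = nsq v"
  using qform_adjoint_mult[of M v] by (simp add: qform_def nsq_def)

lemma qform_spectral:
  assumes "U \<in> carrier_mat n n" "v \<in> carrier_vec n"
  shows "qform (U * rdiag n d * mat_adjoint U) v = (\<Sum>i<n. d i * (cmod ((mat_adjoint U *\<^sub>v v) $ i))\<^sup>2)"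
  using qform_congruence[of "mat_adjoint U" "rdiag n d" v] assms by (simp add: qform_rdiag)

lemma qform_add:
  "A \<in> carrier_mat n n \<Longrightarrow> B \<in> carrier_mat n n \<Longrightarrow> v \<in> carrier_vec n \<Longrightarrow>
    qform (A + B) v = qform A v + qform B v"
  by (simp add: qform_def add_mult_distrib_mat_vec[of _ n n] add_scalar_prod_distrib[of _ n])

lemma qform_minus:
  "A \<in> carrier_mat n n \<Longrightarrow> B \<in> carrier_mat n n \<Longrightarrow> v \<in> carrier_vec n \<Longrightarrow>
    qform (A - B) v = qform A v - qform B v"
  by (simp add: qform_def minus_mult_distrib_mat_vec[of _ n n] minus_scalar_prod_distrib[of _ n])

lemma qform_smult:
  "A \<in> carrier_mat n n \<Longrightarrow> v \<in> carrier_vec n \<Longrightarrow>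
    qform (complex_of_real c \<cdot>\<^sub>m A) v = c * qform A v"
  by (simp add: qform_def smult_mat_mult_vec[of _ n n])

lemma qform_one: "v \<in> carrier_vec n \<Longrightarrow> qform (1\<^sub>m n) v = nsq v"
  by (simp add: qform_def nsq_def)

section \<open>Semidefinite and definite matrices and the signs of their eigenvalues\<close>

lemma hermitian_mat_iff: "A \<in> carrier_mat n n \<Longrightarrow> hermitian_mat A \<longleftrightarrow> mat_adjoint A = A"
  by (auto simp: hermitian_mat_def)

lemma psd_mat_iff:
  "A \<in> carrier_mat n n \<Longrightarrow>
    psd_mat A \<longleftrightarrow> mat_adjoint A = A \<and> (\<forall>v \<in> carrier_vec n. qform A v \<ge> 0)"
  by (auto simp: psd_mat_def hermitian_mat_iff qform_def)

lemma pd_mat_iff: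
  "A \<in> carrier_mat n n \<Longrightarrow>
    pd_mat A \<longleftrightarrow> mat_adjoint A = A \<and> (\<forall>v \<in> carrier_vec n. v \<noteq> 0\<^sub>v n \<longrightarrow> qform A v > 0)"
  by (auto simp: pd_mat_def hermitian_mat_iff qform_def)

lemma unitary_col:
  fixes U :: "complex mat"
  assumes U: "U \<in> carrier_mat n n" "mat_adjoint U * U = 1\<^sub>m n" and i: "i < n"
  shows "mat_adjoint U *\<^sub>v col U i = unit_vec n i" "col U i \<noteq> 0\<^sub>v n" "col U i \<in> carrier_vec n"
proof -
  show c: "col U i \<in> carrier_vec n" using U i by auto
  show eq: "mat_adjoint U *\<^sub>v col U i = unit_vec n i"
    using U i by (metis col_mult2 col_one mat_adjoint_carrier)
  show "col U i \<noteq> 0\<^sub>v n"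
  proof
    assume "col U i = 0\<^sub>v n"
    then have "unit_vec n i = (0\<^sub>v n :: complex vec)"
      using eq U mult_mat_zero_vec[of "mat_adjoint U" n n] by simp
    then show False using i by (metis index_unit_vec(2) index_zero_vec(1) zero_neq_one)
  qed
qed

text \<open>Each diagonal entry is a value of the quadratic form at a nonzero vector, so
  definiteness determines its sign.\<close>

lemma qform_unitary_col:
  assumes U: "U \<in> carrier_mat n n" "mat_adjoint U * U = 1\<^sub>m n" and i: "i < n"
  shows "qform (U * rdiag n d * mat_adjoint U) (col U i) = d i"
  using U i unitary_col[OF U i]
  by (simp add: qform_spectral if_distrib[of cmod] if_distribR sum.delta' unit_vec_def cong: if_cong)
    (simp add: if_distrib[of "\<lambda>x. x\<^sup>2"] if_distrib[of "\<lambda>x. _ * x"] cong: if_cong)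

lemma psd_mat_spectral:
  assumes "A \<in> carrier_mat n n" "psd_mat A"
  obtains U d where "U \<in> carrier_mat n n" "mat_adjoint U * U = 1\<^sub>m n"
    "A = U * rdiag n d * mat_adjoint U" "\<And>i. i < n \<Longrightarrow> d i \<ge> 0"
proof -
  obtain U d where U: "U \<in> carrier_mat n n" "mat_adjoint U * U = 1\<^sub>m n"
    and A: "A = U * rdiag n d * mat_adjoint U"
    using hermitian_spectral[of A n] assms by (auto simp: psd_mat_iff)
  have "d i \<ge> 0" if "i < n" for i
    using qform_unitary_col[OF U that, of d] unitary_col[OF U that] assms A
      by (auto simp: psd_mat_iff)
  then show ?thesis using that U A by blast
qed

lemma pd_mat_spectral:
  assumes "A \<in> carrier_mat n n" "pd_mat A"
  obtains U d where "U \<in> carrier_mat n n" "mat_adjoint U * U = 1\<^sub>m n"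
    "A = U * rdiag n d * mat_adjoint U" "\<And>i. i < n \<Longrightarrow> d i > 0"
proof -
  obtain U d where U: "U \<in> carrier_mat n n" "mat_adjoint U * U = 1\<^sub>m n"
    and A: "A = U * rdiag n d * mat_adjoint U"
    using hermitian_spectral[of A n] assms by (auto simp: pd_mat_iff)
  have "d i > 0" if "i < n" for i
    using qform_unitary_col[OF U that, of d] unitary_col[OF U that] assms A
      by (auto simp: pd_mat_iff)
  then show ?thesis using that U A by blast
qed

text \<open>Simultaneous diagonalization of a positive definite pair by congruence turns every weighted
  mean into a diagonal matrix, with the same congruence for all weights.\<close>

lemma gmean_pd_diagonalize:
  assumes A: "A \<in> carrier_mat n n" "pd_mat A" and B: "B \<in> carrier_mat n n" "pd_mat B"
  obtains S R c where "S \<in> carrier_mat n n" "R \<in> carrier_mat n n" "S * R = 1\<^sub>m n" "R * S = 1\<^sub>m n"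
    "\<And>i. i < n \<Longrightarrow> c i > 0" "A = mat_adjoint S * S" "B = mat_adjoint S * rdiag n c * S"
    "\<And>t. gmean_pd t A B = mat_adjoint S * rdiag n (\<lambda>i. c i powr t) * S"
proof -
  obtain U a where U: "U \<in> carrier_mat n n" "mat_adjoint U * U = 1\<^sub>m n"
    and Aeq: "A = U * rdiag n a * mat_adjoint U" and a: "\<And>i. i < n \<Longrightarrow> a i > 0"
    using pd_mat_spectral[OF A] by blast
  note UU = unitary_mat_right_inverse[OF U]
  define P where "P = mat_powr A (1/2)"
  define Q where "Q = mat_powr A (-1/2)"
  have P: "P = U * rdiag n (\<lambda>i. a i powr (1/2)) * mat_adjoint U"
    and Q: "Q = U * rdiag n (\<lambda>i. a i powr (-1/2)) * mat_adjoint U"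
    unfolding P_def Q_def mat_powr_def by (rule mat_fun_eq[OF U Aeq])+
  have PQc [simp]: "P \<in> carrier_mat n n" "Q \<in> carrier_mat n n"
    unfolding P Q using U by simp_all
  have herm: "mat_adjoint P = P" "mat_adjoint Q = Q"
    unfolding P Q using U by (simp_all add: square_adjoint_mult square_assoc)
  have diag: "(U * rdiag n f * mat_adjoint U) * (U * rdiag n g * mat_adjoint U) =
      U * rdiag n (\<lambda>i. f i * g i) * mat_adjoint U" for f g
  proof -
    have "(U * rdiag n f * mat_adjoint U) * (U * rdiag n g * mat_adjoint U) =
      U * (rdiag n f * rdiag n g) * mat_adjoint U"
      using U by (simp add: square_assoc square_cancel[OF U(2)])
    then show ?thesis by (simp add: rdiag_mult)
  qed
  have PP: "P * P = A"
    unfolding P diag Aeq using a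
    by (subst rdiag_cong[of n _ a]) (auto simp: less_imp_le simp flip: powr_add)
  have "rdiag n (\<lambda>i. a i powr (1/2) * a i powr (-1/2)) = 1\<^sub>m n"
    "rdiag n (\<lambda>i. a i powr (-1/2) * a i powr (1/2)) = 1\<^sub>m n"
    using a by (auto intro!: rdiag_one simp: less_imp_neq[THEN not_sym] simp flip: powr_add)
  then have PQ: "P * Q = 1\<^sub>m n" "Q * P = 1\<^sub>m n"
    unfolding P Q diag using U UU by (simp_all add: right_mult_one_mat[of _ n n])
  define C where "C = Q * B * Q"
  have C: "C \<in> carrier_mat n n" using B by (simp add: C_def)
  have "pd_mat C"
    unfolding pd_mat_iff[OF C]
  proof (intro conjI ballI impI)
    show "mat_adjoint C = C"
      using B herm unfolding C_def pd_mat_iff[OF B(1)]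
        by (simp add: square_adjoint_mult square_assoc)
  next
    fix v assume v: "v \<in> carrier_vec n" "v \<noteq> (0\<^sub>v n :: complex vec)"
    have "Q *\<^sub>v v \<noteq> 0\<^sub>v n"
      using square_cancel_vec[OF PQ(1) _ _ v(1)] v mult_mat_zero_vec[of P n n] by auto
    then show "qform C v > 0"
      using qform_congruence[of Q B v] B v herm
      by (simp add: C_def pd_mat_iff)
  qed
  then obtain V c where V: "V \<in> carrier_mat n n" "mat_adjoint V * V = 1\<^sub>m n"
    and Ceq: "C = V * rdiag n c * mat_adjoint V" and c: "\<And>i. i < n \<Longrightarrow> c i > 0"
    using pd_mat_spectral[OF C] by blast
  note VV = unitary_mat_right_inverse[OF V]
  \<comment> \<open>\<open>S* S = P V V* P = A\<close> because \<open>V\<close> is unitary, and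
    \<open>S* diag(c) S = P C P = B\<close>. So \<open>c\<close> collects the eigenvalues of
    \<open>A^(-1/2) B A^(-1/2)\<close>, and raising them to the power \<open>t\<close> reproduces
    the definition of the mean.\<close>
  define S where "S = mat_adjoint V * P"
  define R where "R = Q * V"
  have S': "mat_adjoint S = P * V"
    using V by (simp add: S_def square_adjoint_mult herm)
  show ?thesis
  proof (rule that)
    show "S \<in> carrier_mat n n" "R \<in> carrier_mat n n"
      using V by (simp_all add: S_def R_def)
    show "S * R = 1\<^sub>m n" "R * S = 1\<^sub>m n"
      using V by (simp_all add: S_def R_def square_assoc square_cancel[OF PQ(1)] square_cancel[OF VV] PQ)
    show "c i > 0" if "i < n" for i using c that .
    show "A = mat_adjoint S * S"
      unfolding S' using V PP by (simp add: S_def square_assoc square_cancel[OF VV])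
    have "B = P * (Q * B * Q) * P"
      using B by (simp add: square_assoc square_cancel[OF PQ(1)] PQ right_mult_one_mat[of _ n n])
    also have "\<dots> = mat_adjoint S * rdiag n c * S"
      unfolding C_def[symmetric] Ceq S' using V by (simp add: S_def square_assoc)
    finally show "B = mat_adjoint S * rdiag n c * S" .
    show "gmean_pd t A B = mat_adjoint S * rdiag n (\<lambda>i. c i powr t) * S" for t
    proof -
      have "mat_powr C t = V * rdiag n (\<lambda>i. c i powr t) * mat_adjoint V"
        unfolding mat_powr_def by (rule mat_fun_eq[OF V Ceq])
      then show ?thesis
        unfolding gmean_pd_def P_def[symmetric] Q_def[symmetric] C_def[symmetric] S'
        using V by (simp add: S_def square_assoc)
    qed
  qed
qed

section \<open>Interpolation\<close>

lemma rdiag_mult_vec_rdiag: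
  "v \<in> carrier_vec n \<Longrightarrow> rdiag n f *\<^sub>v (rdiag n g *\<^sub>v v) = rdiag n (\<lambda>i. f i * g i) *\<^sub>v v"
  by (simp add: rdiag_mult flip: square_assoc_vec)

lemma rdiag_mult_vec_one:
  "v \<in> carrier_vec n \<Longrightarrow> (\<And>i. i < n \<Longrightarrow> f i = 1) \<Longrightarrow> rdiag n f *\<^sub>v v = v"
  by (simp add: rdiag_one)

text \<open>With \<open>u = M* w\<close>, the number \<open>2 |u|^2 = 2 Re <M u, w>\<close> is at
  most \<open>|M u|^2 / c + c |w|^2\<close>, whose first term is at most \<open>|u|^2\<close> and
  can be absorbed on the left.\<close>

lemma nsq_adjoint_bound:
  assumes M: "M \<in> carrier_mat n n" and c: "c > 0"
    and bound: "\<And>v. v \<in> carrier_vec n \<Longrightarrow> nsq (M *\<^sub>v v) \<le> c * nsq v"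
    and w: "w \<in> carrier_vec n"
  shows "nsq (mat_adjoint M *\<^sub>v w) \<le> c * nsq w"
proof -
  define u where "u = mat_adjoint M *\<^sub>v w"
  have u: "u \<in> carrier_vec n" using M w by (simp add: u_def)
  have "2 * nsq u = 2 * Re ((M *\<^sub>v u) \<bullet>c w)"
    using M u w by (simp add: cscalar_prod_adjoint[of M n n] nsq_def u_def)
  also have "\<dots> \<le> (1 / c) * nsq (M *\<^sub>v u) + nsq w / (1 / c)"
    using M u w c by (intro Re_cscalar_prod_le[of _ n]) auto
  also have "\<dots> \<le> (1 / c) * (c * nsq u) + nsq w / (1 / c)"
    using c bound[OF u] by (intro add_right_mono mult_left_mono) auto
  finally show ?thesis using c by (simp add: u_def mult.commute)
qed

text \<open>The constant is the trace of \<open>M* M\<close>, which dominates every eigenvalue; a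
  sum, unlike a maximum, also makes sense for \<open>n = 0\<close>.\<close>

lemma nsq_bound_exists:
  assumes M: "M \<in> carrier_mat n n"
  obtains c where "c \<ge> 0" "\<And>v. v \<in> carrier_vec n \<Longrightarrow> nsq (M *\<^sub>v v) \<le> c * nsq v"
proof -
  have H: "mat_adjoint M * M \<in> carrier_mat n n" "psd_mat (mat_adjoint M * M)"
    using M by (auto simp: psd_mat_iff square_adjoint_mult qform_adjoint_mult)
  obtain U a where U: "U \<in> carrier_mat n n" "mat_adjoint U * U = 1\<^sub>m n"
    and Heq: "mat_adjoint M * M = U * rdiag n a * mat_adjoint U" and a: "\<And>i. i < n \<Longrightarrow> a i \<ge> 0"
    using psd_mat_spectral[OF H] by blast
  have "nsq (M *\<^sub>v v) \<le> (\<Sum>i<n. a i) * nsq v" if v: "v \<in> carrier_vec n" for v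
  proof -
    have "nsq (M *\<^sub>v v) = (\<Sum>i<n. a i * (cmod ((mat_adjoint U *\<^sub>v v) $ i))\<^sup>2)"
      using qform_spectral[OF U(1) v, of a] Heq qform_adjoint_mult[OF M v] by simp
    also have "\<dots> \<le> (\<Sum>i<n. (\<Sum>i<n. a i) * (cmod ((mat_adjoint U *\<^sub>v v) $ i))\<^sup>2)"
      using a by (intro sum_mono mult_right_mono member_le_sum) auto
    also have "\<dots> = (\<Sum>i<n. a i) * nsq (mat_adjoint U *\<^sub>v v)"
      using U v by (simp add: nsq_sum[of _ n] sum_distrib_left)
    also have "nsq (mat_adjoint U *\<^sub>v v) = nsq v"
      using U v unitary_mat_right_inverse[OF U] by (intro nsq_unitary) auto
    finally show ?thesis .
  qed
  then show ?thesis
    using a by (intro that[of "\<Sum>i<n. a i"]) (auto intro: sum_nonneg)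
qed

lemma nsq_rdiag_le:
  assumes "v \<in> carrier_vec n" "\<And>i. i < n \<Longrightarrow> \<bar>f i\<bar> \<le> K"
  shows "nsq (rdiag n f *\<^sub>v v) \<le> K\<^sup>2 * nsq v"
proof -
  have "(f i)\<^sup>2 \<le> K\<^sup>2" if "i < n" for i
    using assms(2)[OF that] by (metis abs_ge_zero power2_abs power_mono)
  then show ?thesis
    using assms(1) by (auto simp: nsq_rdiag nsq_sum[of _ n] sum_distrib_left norm_mult power_mult_distrib
      intro!: sum_mono mult_right_mono)
qed

text \<open>The family \<open>D^t Y E^(-t)\<close> of the three lines theorem, at real parameters.
  The two diagonals are kept apart because \<open>gmean_pd_mono\<close> relates means that come from
  two different diagonalizations.\<close>

definition interp :: "(nat \<Rightarrow> real) \<Rightarrow> complex mat \<Rightarrow> (nat \<Rightarrow> real) \<Rightarrow> real \<Rightarrow> complex mat" where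
  "interp d Y e t = rdiag n (\<lambda>i. d i powr t) * Y * rdiag n (\<lambda>i. e i powr (-t))"

lemma interp_carrier [simp]: "Y \<in> carrier_mat n n \<Longrightarrow> interp d Y e t \<in> carrier_mat n n"
  by (simp add: interp_def)

lemma interp_mult_vec:
  "Y \<in> carrier_mat n n \<Longrightarrow> v \<in> carrier_vec n \<Longrightarrow>
   interp d Y e t *\<^sub>v v = rdiag n (\<lambda>i. d i powr t) *\<^sub>v (Y *\<^sub>v (rdiag n (\<lambda>i. e i powr (-t)) *\<^sub>v v))"
  by (simp add: interp_def square_assoc_vec)

lemma interp_shift:
  assumes "Y \<in> carrier_mat n n"
  shows "interp d Y e (m + h) = rdiag n (\<lambda>i. d i powr h) * interp d Y e m * rdiag n (\<lambda>i. e i powr (-h))"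
proof -
  have "rdiag n (\<lambda>i. d i powr h) * interp d Y e m * rdiag n (\<lambda>i. e i powr (-h)) =
      (rdiag n (\<lambda>i. d i powr h) * rdiag n (\<lambda>i. d i powr m)) * Y *
      (rdiag n (\<lambda>i. e i powr (-m)) * rdiag n (\<lambda>i. e i powr (-h)))"
    using assms by (simp add: interp_def square_assoc)
  then show ?thesis
    by (simp add: interp_def rdiag_mult flip: powr_add) (simp add: add.commute)
qed

lemma rdiag_powr_cancel:
  assumes "\<And>i. i < n \<Longrightarrow> d i > 0"
  shows "rdiag n (\<lambda>i. d i powr h) * rdiag n (\<lambda>i. d i powr (-h)) = 1\<^sub>m n"
    "rdiag n (\<lambda>i. d i powr (-h)) * rdiag n (\<lambda>i. d i powr h) = 1\<^sub>m n"
  unfolding rdiag_mult using assms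
  by (auto intro!: rdiag_one simp: less_imp_neq[THEN not_sym] simp flip: powr_add)

text \<open>Write \<open>M s\<close> for \<open>interp d Y e s\<close>. The matrix \<open>(M q)* (M p)\<close> is similar to
  \<open>(M m)* (M m)\<close> for the midpoint \<open>m\<close> of \<open>p\<close> and \<open>q\<close>, so the norms bound the
  eigenvalues of the latter.\<close>

lemma interp_midpoint:
  assumes Y: "Y \<in> carrier_mat n n"
    and d: "\<And>i. i < n \<Longrightarrow> d i > 0" and e: "\<And>i. i < n \<Longrightarrow> e i > 0"
    and c: "c > 0" "c' > 0"
    and bp: "\<And>v. v \<in> carrier_vec n \<Longrightarrow> nsq (interp d Y e p *\<^sub>v v) \<le> c * nsq v"
    and bq: "\<And>v. v \<in> carrier_vec n \<Longrightarrow> nsq (interp d Y e q *\<^sub>v v) \<le> c' * nsq v"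
    and v: "v \<in> carrier_vec n"
  shows "nsq (interp d Y e ((p + q) / 2) *\<^sub>v v) \<le> sqrt (c * c') * nsq v"
proof -
  define h where "h = (q - p) / 2"
  define F where "F = interp d Y e ((p + q) / 2)"
  define Dp where "Dp = rdiag n (\<lambda>i. d i powr h)"
  define Dm where "Dm = rdiag n (\<lambda>i. d i powr (-h))"
  define Ep where "Ep = rdiag n (\<lambda>i. e i powr h)"
  define Em where "Em = rdiag n (\<lambda>i. e i powr (-h))"
  have [simp]: "Dp \<in> carrier_mat n n" "Dm \<in> carrier_mat n n" "Ep \<in> carrier_mat n n" "Em \<in> carrier_mat n n"
    by (simp_all add: Dp_def Dm_def Ep_def Em_def)
  have adj: "mat_adjoint Dp = Dp" "mat_adjoint Em = Em"
    by (simp_all add: Dp_def Em_def)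
  have F [simp]: "F \<in> carrier_mat n n" using Y by (simp add: F_def)
  have "(p + q) / 2 + h = q" "(p + q) / 2 + (-h) = p"
    by (simp_all add: h_def field_simps)
  then have Fq: "interp d Y e q = Dp * F * Em" and Fp: "interp d Y e p = Dm * F * Ep"
    using interp_shift[OF Y, of d e "(p + q) / 2" h] interp_shift[OF Y, of d e "(p + q) / 2" "-h"]
    by (simp_all add: F_def Dp_def Dm_def Ep_def Em_def)
  have DD: "Dp * Dm = 1\<^sub>m n" "Dm * Dp = 1\<^sub>m n"
    unfolding Dp_def Dm_def by (rule rdiag_powr_cancel; fact d)+
  have EE: "Ep * Em = 1\<^sub>m n" "Em * Ep = 1\<^sub>m n"
    unfolding Ep_def Em_def by (rule rdiag_powr_cancel; fact e)+
  have H: "mat_adjoint F * F \<in> carrier_mat n n" "psd_mat (mat_adjoint F * F)"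
    by (auto simp: psd_mat_iff square_adjoint_mult qform_adjoint_mult)
  obtain U a where U: "U \<in> carrier_mat n n" "mat_adjoint U * U = 1\<^sub>m n"
    and Heq: "mat_adjoint F * F = U * rdiag n a * mat_adjoint U" and a: "\<And>i. i < n \<Longrightarrow> a i \<ge> 0"
    using psd_mat_spectral[OF H] by blast
  have bound: "a i \<le> sqrt (c * c')" if i: "i < n" for i
  proof -
    define u where "u = col U i"
    have u: "u \<in> carrier_vec n" "u \<noteq> 0\<^sub>v n" "mat_adjoint U *\<^sub>v u = unit_vec n i"
      unfolding u_def using unitary_col[OF U i] by auto
    \<comment> \<open>The eigenvector \<open>u\<close> of \<open>F* F\<close> carried over by the
      similarity: in the product of the adjoint at \<open>q\<close> with the matrix at
      \<open>p\<close> the factors \<open>D^h\<close> and \<open>D^(-h)\<close> cancel, leaving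
      \<open>E^(-h) F* F E^h\<close>, for which \<open>w\<close> is an eigenvector with the same
      eigenvalue.\<close>
    define w where "w = Em *\<^sub>v u"
    have w: "w \<in> carrier_vec n" using u by (simp add: w_def)
    have "w \<noteq> 0\<^sub>v n"
      using square_cancel_vec[OF EE(1) _ _ u(1)] u mult_mat_zero_vec[of Ep n n]
        by (auto simp: w_def)
    then have w0: "nsq w > 0" using nsq_pos[OF w] by simp
    have "(mat_adjoint F * F) *\<^sub>v u = U *\<^sub>v (rdiag n a *\<^sub>v unit_vec n i)"
      unfolding Heq using U u by (simp add: square_assoc_vec)
    also have "rdiag n a *\<^sub>v unit_vec n i = complex_of_real (a i) \<cdot>\<^sub>v unit_vec n i"
      using i by (intro eq_vecI) (auto)
    also have "U *\<^sub>v \<dots> = complex_of_real (a i) \<cdot>\<^sub>v u"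
      using U u i square_cancel_vec[OF unitary_mat_right_inverse[OF U] _ _ u(1)]
      by (simp add: mult_mat_vec[of _ n n])
    finally have Hu: "mat_adjoint F *\<^sub>v (F *\<^sub>v u) = complex_of_real (a i) \<cdot>\<^sub>v u"
      using u by (simp add: square_assoc_vec)
    have "mat_adjoint (interp d Y e q) *\<^sub>v (interp d Y e p *\<^sub>v w) = Em *\<^sub>v (mat_adjoint F *\<^sub>v (F *\<^sub>v u))"
      unfolding Fq Fp w_def using u
      by (simp add: square_adjoint_mult adj square_assoc_vec square_cancel_vec[OF DD(1)] square_cancel_vec[OF EE(1)])
    also have "\<dots> = complex_of_real (a i) \<cdot>\<^sub>v w"
      unfolding Hu w_def using u by (simp add: mult_mat_vec[of _ n n])
    finally have "(a i)\<^sup>2 * nsq w = nsq (mat_adjoint (interp d Y e q) *\<^sub>v (interp d Y e p *\<^sub>v w))"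
      by (simp add: nsq_smult)
    also have "\<dots> \<le> c' * nsq (interp d Y e p *\<^sub>v w)"
      using Y w c by (intro nsq_adjoint_bound bq) auto
    also have "\<dots> \<le> c' * (c * nsq w)"
      using c bp[OF w] by (intro mult_left_mono) auto
    finally have "(a i)\<^sup>2 \<le> c * c'"
      using w0 by (simp add: mult.commute mult.left_commute)
    then show ?thesis by (rule real_le_rsqrt)
  qed
  have "nsq (F *\<^sub>v v) = (\<Sum>i<n. a i * (cmod ((mat_adjoint U *\<^sub>v v) $ i))\<^sup>2)"
    using qform_spectral[OF U(1) v, of a] Heq qform_adjoint_mult[OF F v] by simp
  also have "\<dots> \<le> (\<Sum>i<n. sqrt (c * c') * (cmod ((mat_adjoint U *\<^sub>v v) $ i))\<^sup>2)"
    using bound by (intro sum_mono mult_right_mono) auto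
  also have "\<dots> = sqrt (c * c') * nsq (mat_adjoint U *\<^sub>v v)"
    using U v by (simp add: nsq_sum[of _ n] sum_distrib_left)
  also have "nsq (mat_adjoint U *\<^sub>v v) = nsq v"
    using U v unitary_mat_right_inverse[OF U] by (intro nsq_unitary) auto
  finally show ?thesis by (simp add: F_def)
qed

text \<open>A crude bound, factor by factor, that gives the self-improvement in
  \<open>interp_contraction\<close> a finite constant to start from. The summand 1 in the constant
  ensures \<open>c \<ge> 1\<close>.\<close>

lemma interp_bounded:
  assumes Y: "Y \<in> carrier_mat n n"
    and d: "\<And>i. i < n \<Longrightarrow> d i > 0" and e: "\<And>i. i < n \<Longrightarrow> e i > 0"
  shows "\<exists>c\<ge>1. \<forall>t \<in> {0..1}. \<forall>v \<in> carrier_vec n. nsq (interp d Y e t *\<^sub>v v) \<le> c * nsq v"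
proof -
  obtain k where k: "k \<ge> 0" "\<And>v. v \<in> carrier_vec n \<Longrightarrow> nsq (Y *\<^sub>v v) \<le> k * nsq v"
    using nsq_bound_exists[OF Y] by blast
  define D where "D = 1 + (\<Sum>i<n. d i)"
  define E where "E = 1 + (\<Sum>i<n. 1 / e i)"
  have D: "\<bar>d i powr t\<bar> \<le> D" if "i < n" "t \<in> {0..1}" for i t
  proof -
    have "d i \<le> (\<Sum>i<n. d i)" using that d by (intro member_le_sum) (auto simp: less_imp_le)
    then show ?thesis
      using powr_le_one_plus[OF d[OF that(1)], of t] that by (simp add: D_def)
  qed
  have E: "\<bar>e i powr (-t)\<bar> \<le> E" if "i < n" "t \<in> {0..1}" for i t
  proof -
    have "1 / e i \<le> (\<Sum>i<n. 1 / e i)" using that e by (intro member_le_sum) (auto simp: less_imp_le)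
    moreover have "e i powr (-t) = (1 / e i) powr t"
      using e[OF that(1)] by (simp add: powr_minus_divide powr_divide)
    ultimately show ?thesis
      using powr_le_one_plus[of "1 / e i" t] e[OF that(1)] that by (simp add: E_def)
  qed
  have "nsq (interp d Y e t *\<^sub>v v) \<le> (1 + D\<^sup>2 * (k * E\<^sup>2)) * nsq v"
    if t: "t \<in> {0..1}" and v: "v \<in> carrier_vec n" for t v
  proof -
    define y where "y = rdiag n (\<lambda>i. e i powr (-t)) *\<^sub>v v"
    have y: "y \<in> carrier_vec n" using v by (simp add: y_def)
    have "nsq (interp d Y e t *\<^sub>v v) \<le> D\<^sup>2 * nsq (Y *\<^sub>v y)"
      unfolding interp_mult_vec[OF Y v] y_def[symmetric]
      using Y y D t by (intro nsq_rdiag_le) auto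
    also have "\<dots> \<le> D\<^sup>2 * (k * (E\<^sup>2 * nsq v))"
    proof (intro mult_left_mono)
      have "nsq y \<le> E\<^sup>2 * nsq v"
        unfolding y_def using v E t by (intro nsq_rdiag_le) auto
      then have "k * nsq y \<le> k * (E\<^sup>2 * nsq v)"
        using k by (intro mult_left_mono) auto
      then show "nsq (Y *\<^sub>v y) \<le> k * (E\<^sup>2 * nsq v)"
        using k(2)[OF y] by linarith
    qed simp
    also have "\<dots> \<le> nsq v + D\<^sup>2 * (k * (E\<^sup>2 * nsq v))" by simp
    finally show ?thesis by (simp add: algebra_simps)
  qed
  then show ?thesis
    using k by (intro exI[of _ "1 + D\<^sup>2 * (k * E\<^sup>2)"]) auto
qed

text \<open>A discrete substitute for the three lines theorem: every \<open>t\<close> in the unit interval is the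
  midpoint of an end point and another point of the interval, so a common bound \<open>c\<close> for the
  squared norms can be improved to \<open>sqrt c\<close>.\<close>

theorem interp_contraction:
  assumes Y: "Y \<in> carrier_mat n n"
    and d: "\<And>i. i < n \<Longrightarrow> d i > 0" and e: "\<And>i. i < n \<Longrightarrow> e i > 0"
    and b0: "\<And>v. v \<in> carrier_vec n \<Longrightarrow> nsq (interp d Y e 0 *\<^sub>v v) \<le> nsq v"
    and b1: "\<And>v. v \<in> carrier_vec n \<Longrightarrow> nsq (interp d Y e 1 *\<^sub>v v) \<le> nsq v"
    and t: "0 \<le> t" "t \<le> 1" and v: "v \<in> carrier_vec n"
  shows "nsq (interp d Y e t *\<^sub>v v) \<le> nsq v"
proof -
  \<comment> \<open>The condition \<open>1 \<le> c\<close> keeps the infimum positive, as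
    \<open>interp_midpoint\<close> requires, and it survives taking square roots.\<close>
  define S where "S = {c. 1 \<le> c \<and>
    (\<forall>t \<in> {0..1}. \<forall>v \<in> carrier_vec n. nsq (interp d Y e t *\<^sub>v v) \<le> c * nsq v)}"
  obtain k where k: "k \<in> S"
    using interp_bounded[where d=d and e=e, OF Y d e] by (auto simp: S_def)
  have bdd: "bdd_below S" unfolding S_def by (rule bdd_belowI[of _ 1]) auto
  define c where "c = Inf S"
  have c1: "c \<ge> 1" unfolding c_def using k by (intro cInf_greatest) (auto simp: S_def)
  \<comment> \<open>The infimum is itself an admissible bound. Dividing by \<open>nsq v\<close>
    turns this into the definition of an infimum; when \<open>nsq v = 0\<close>, the member
    \<open>k\<close> of \<open>S\<close> settles it.\<close>
  have cb: "nsq (interp d Y e t *\<^sub>v v) \<le> c * nsq v" if "t \<in> {0..1}" "v \<in> carrier_vec n" for t v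
  proof (cases "nsq v = 0")
    case True
    have "nsq (interp d Y e t *\<^sub>v v) \<le> k * nsq v" using k that by (auto simp: S_def)
    then show ?thesis using True by simp
  next
    case False
    then have pos: "nsq v > 0" using nsq_nonneg[of v] by linarith
    have "nsq (interp d Y e t *\<^sub>v v) / nsq v \<le> c"
      unfolding c_def
    proof (rule cInf_greatest)
      show "S \<noteq> {}" using k by blast
      show "nsq (interp d Y e t *\<^sub>v v) / nsq v \<le> x" if "x \<in> S" for x
        using that pos \<open>t \<in> {0..1}\<close> \<open>v \<in> carrier_vec n\<close> by (auto simp: S_def pos_divide_le_eq)
    qed
    then show ?thesis using pos by (simp add: pos_divide_le_eq)
  qed
  have "nsq (interp d Y e t *\<^sub>v v) \<le> sqrt c * nsq v" if t: "t \<in> {0..1}"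
    and v: "v \<in> carrier_vec n" for t v
  proof (cases "t \<le> 1/2")
    case True
    have "nsq (interp d Y e ((0 + 2 * t) / 2) *\<^sub>v v) \<le> sqrt (1 * c) * nsq v"
      using c1 b0 cb[of "2 * t"] True t by (intro interp_midpoint Y d e v) auto
    then show ?thesis by simp
  next
    case False
    have "nsq (interp d Y e (((2 * t - 1) + 1) / 2) *\<^sub>v v) \<le> sqrt (c * 1) * nsq v"
      using c1 b1 cb[of "2 * t - 1"] False t by (intro interp_midpoint Y d e v) auto
    then show ?thesis by simp
  qed
  then have "sqrt c \<in> S" using c1 by (auto simp: S_def)
  then have "c \<le> sqrt c" unfolding c_def by (rule cInf_lower[OF _ bdd])
  then have "c * c \<le> sqrt c * sqrt c" using c1 by (intro mult_mono) auto
  then have "c * c \<le> c" using c1 by simp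
  then have "c \<le> 1" using c1 by simp
  with c1 have "c = 1" by simp
  then show ?thesis using cb[of t v] t v by simp
qed

text \<open>The means carry the weights \<open>c^t\<close>, the interpolation uses the powers
  \<open>d^t\<close> of \<open>d = c^(1/2)\<close>; the square in \<open>nsq\<close> accounts for
  the difference.\<close>

lemma qform_rdiag_powr:
  assumes "\<And>i. i < n \<Longrightarrow> c i > 0" "w \<in> carrier_vec n"
  shows "qform (rdiag n (\<lambda>i. c i powr t)) w = nsq (rdiag n (\<lambda>i. (c i powr (1/2)) powr t) *\<^sub>v w)"
  using assms by (auto simp: qform_rdiag nsq_rdiag powr_powr power2_eq_square simp flip: powr_add
    intro!: sum.cong)

lemma qform_rdiag_sqrt:
  assumes "\<And>i. i < n \<Longrightarrow> c i > 0" "w \<in> carrier_vec n"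
  shows "qform (rdiag n c) w = nsq (rdiag n (\<lambda>i. c i powr (1/2)) *\<^sub>v w)"
  using assms by (auto simp: qform_rdiag nsq_rdiag power2_eq_square less_imp_le simp flip: powr_add
    intro!: sum.cong)

section \<open>Weighted geometric means\<close>

text \<open>With \<open>A = S* S\<close>, \<open>B = S* D^2 S\<close>, \<open>A' = T* T\<close> and
  \<open>B' = T* F^2 T\<close>, consider \<open>M s = D^s S T^(-1) F^(-s)\<close>. That
  \<open>M 0\<close> is a contraction says that the form of \<open>A\<close> is below that of
  \<open>A'\<close>, and for \<open>M 1\<close> the same holds with \<open>B\<close> and
  \<open>B'\<close>. The contraction \<open>M t\<close> in between, applied to
  \<open>F^t T v\<close>, is the claim.\<close>

theorem gmean_pd_mono:
  assumes A: "A \<in> carrier_mat n n" "pd_mat A" and B: "B \<in> carrier_mat n n" "pd_mat B"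
    and A': "A' \<in> carrier_mat n n" "pd_mat A'" and B': "B' \<in> carrier_mat n n" "pd_mat B'"
    and AA: "\<And>v. v \<in> carrier_vec n \<Longrightarrow> qform A v \<le> qform A' v"
    and BB: "\<And>v. v \<in> carrier_vec n \<Longrightarrow> qform B v \<le> qform B' v"
    and t: "0 \<le> t" "t \<le> 1" and v: "v \<in> carrier_vec n"
  shows "qform (gmean_pd t A B) v \<le> qform (gmean_pd t A' B') v"
proof -
  obtain S R c where S: "S \<in> carrier_mat n n" and c: "\<And>i. i < n \<Longrightarrow> c i > 0"
    and ASS: "A = mat_adjoint S * S" and BSS: "B = mat_adjoint S * rdiag n c * S"
    and GS: "\<And>t. gmean_pd t A B = mat_adjoint S * rdiag n (\<lambda>i. c i powr t) * S"
    using gmean_pd_diagonalize[OF A B] by blast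
  obtain T Q e where T: "T \<in> carrier_mat n n" and Q: "Q \<in> carrier_mat n n"
    and TQ: "T * Q = 1\<^sub>m n" "Q * T = 1\<^sub>m n" and e: "\<And>i. i < n \<Longrightarrow> e i > 0"
    and ATT: "A' = mat_adjoint T * T" and BTT: "B' = mat_adjoint T * rdiag n e * T"
    and GT: "\<And>t. gmean_pd t A' B' = mat_adjoint T * rdiag n (\<lambda>i. e i powr t) * T"
    using gmean_pd_diagonalize[OF A' B'] by blast
  define d where "d = (\<lambda>i. c i powr (1/2))"
  define f where "f = (\<lambda>i. e i powr (1/2))"
  have d: "d i > 0" and f: "f i > 0" if "i < n" for i
    using c[OF that] e[OF that] by (simp_all add: d_def f_def)
  define Y where "Y = S * Q"
  have Y: "Y \<in> carrier_mat n n" using S Q by (simp add: Y_def)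
  define w where "w = rdiag n (\<lambda>i. f i powr t) *\<^sub>v (T *\<^sub>v v)"
  have w: "w \<in> carrier_vec n" using T v by (simp add: w_def)
  have "nsq (interp d Y f t *\<^sub>v w) \<le> nsq w"
  proof (rule interp_contraction[where d=d and e=f, OF Y d f _ _ t w])
    fix u :: "complex vec" assume u: "u \<in> carrier_vec n"
    have "interp d Y f 0 *\<^sub>v u = S *\<^sub>v (Q *\<^sub>v u)"
      using Y u S Q d f
      by (simp add: interp_mult_vec rdiag_mult_vec_one less_imp_neq[THEN not_sym] Y_def square_assoc_vec)
    then have "nsq (interp d Y f 0 *\<^sub>v u) = qform A (Q *\<^sub>v u)"
      unfolding ASS using S Q u by (simp add: qform_adjoint_mult)
    also have "\<dots> \<le> qform A' (Q *\<^sub>v u)" using AA Q u by simp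
    also have "\<dots> = nsq u"
      unfolding ATT using T Q u by (simp add: qform_adjoint_mult square_cancel_vec[OF TQ(1)])
    finally show "nsq (interp d Y f 0 *\<^sub>v u) \<le> nsq u" .
    define y where "y = Q *\<^sub>v (rdiag n (\<lambda>i. f i powr (-1)) *\<^sub>v u)"
    have y: "y \<in> carrier_vec n" using Q u by (simp add: y_def)
    have "interp d Y f 1 *\<^sub>v u = rdiag n (\<lambda>i. d i powr 1) *\<^sub>v (S *\<^sub>v y)"
      using Y u S Q by (simp add: interp_mult_vec Y_def y_def square_assoc_vec)
    also have "nsq \<dots> = qform B y"
      unfolding BSS using S y c qform_rdiag_powr[where c=c and w="S *\<^sub>v y" and t=1, OF c]
      by (simp add: qform_congruence d_def qform_rdiag_sqrt)
    also have "\<dots> \<le> qform B' y" using BB y by simp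
    also have "\<dots> = nsq (rdiag n f *\<^sub>v (rdiag n (\<lambda>i. f i powr (-1)) *\<^sub>v u))"
      unfolding BTT using T y e Q u qform_rdiag_sqrt[where c=e and w="T *\<^sub>v y", OF e]
      by (simp add: qform_congruence f_def y_def square_cancel_vec[OF TQ(1)])
    also have "rdiag n f *\<^sub>v (rdiag n (\<lambda>i. f i powr (-1)) *\<^sub>v u) = u"
      unfolding rdiag_mult_vec_rdiag[OF u] using u f
      by (intro rdiag_mult_vec_one)
        (auto simp: powr_minus_divide less_imp_le less_imp_neq[THEN not_sym])
    finally show "nsq (interp d Y f 1 *\<^sub>v u) \<le> nsq u" .
  qed
  moreover have "interp d Y f t *\<^sub>v w = rdiag n (\<lambda>i. d i powr t) *\<^sub>v (S *\<^sub>v v)"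
    unfolding w_def using Y S Q T v
    by (simp add: interp_mult_vec square_cancel_vec[OF rdiag_powr_cancel(2)[where d=f, OF f]] Y_def square_assoc_vec square_cancel_vec[OF TQ(2)])
  ultimately show ?thesis
    unfolding GS GT using S T v c e
    by (simp add: qform_congruence qform_rdiag_powr d_def f_def w_def)
qed

text \<open>The hypotheses \<open>AB\<close> and \<open>BA\<close> are the two block conditions
  written as forms in two vectors. Minimizing each over its second vector, as for a Schur
  complement, yields the two end point contractions; the conclusion is the interpolated contraction
  read back as a form.\<close>

theorem ppt_gmean_pd:
  assumes A: "A \<in> carrier_mat n n" "pd_mat A" and B: "B \<in> carrier_mat n n" "pd_mat B"
    and X: "X \<in> carrier_mat n n"
    and AB: "\<And>v w. v \<in> carrier_vec n \<Longrightarrow> w \<in> carrier_vec n \<Longrightarrow>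
      0 \<le> qform A v + 2 * Re ((X *\<^sub>v v) \<bullet>c w) + qform B w"
    and BA: "\<And>v w. v \<in> carrier_vec n \<Longrightarrow> w \<in> carrier_vec n \<Longrightarrow>
      0 \<le> qform B v + 2 * Re ((X *\<^sub>v v) \<bullet>c w) + qform A w"
    and t: "0 \<le> t" "t \<le> 1" and v: "v \<in> carrier_vec n" and w: "w \<in> carrier_vec n"
  shows "2 * Re ((X *\<^sub>v v) \<bullet>c w) \<le> qform (gmean_pd t A B) v + qform (gmean_pd (1 - t) A B) w"
proof -
  obtain S R c where S: "S \<in> carrier_mat n n" and R: "R \<in> carrier_mat n n"
    and SR: "S * R = 1\<^sub>m n" "R * S = 1\<^sub>m n" and c: "\<And>i. i < n \<Longrightarrow> c i > 0"
    and ASS: "A = mat_adjoint S * S" and BSS: "B = mat_adjoint S * rdiag n c * S"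
    and G: "\<And>t. gmean_pd t A B = mat_adjoint S * rdiag n (\<lambda>i. c i powr t) * S"
    using gmean_pd_diagonalize[OF A B] by blast
  define d where "d = (\<lambda>i. c i powr (1/2))"
  have d: "d i > 0" if "i < n" for i
    using c[OF that] by (simp add: d_def)
  have d2: "(d i)\<^sup>2 = c i" if "i < n" for i
    using c[OF that] by (simp add: d_def power2_eq_square flip: powr_add)
  have dm: "(d i powr (-1))\<^sup>2 = 1 / c i" if "i < n" for i
    using d[OF that] d2[OF that] by (simp add: powr_minus_divide power_divide)
  define Y where "Y = mat_adjoint R * X * R"
  have Y: "Y \<in> carrier_mat n n" using X R by (simp add: Y_def)
  have XY: "(X *\<^sub>v (R *\<^sub>v x)) \<bullet>c (R *\<^sub>v y) = (Y *\<^sub>v x) \<bullet>c y"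
    if "x \<in> carrier_vec n" "y \<in> carrier_vec n" for x y
    using cscalar_prod_adjoint[of "mat_adjoint R" n n "X *\<^sub>v (R *\<^sub>v x)" y] that X R
    by (simp add: Y_def square_assoc_vec)
  have qA: "qform A (R *\<^sub>v x) = nsq x" and qB: "qform B (R *\<^sub>v x) = qform (rdiag n c) x"
    if "x \<in> carrier_vec n" for x
    unfolding ASS BSS using S R that
    by (simp_all add: qform_adjoint_mult qform_congruence square_cancel_vec[OF SR(1)])
  \<comment> \<open>The extra factor \<open>D^(-1)\<close> shifts one exponent, so that
    \<open>interp d Z d t\<close> is \<open>D^(t-1) Y D^(-t)\<close>.\<close>
  define Z where "Z = rdiag n (\<lambda>i. d i powr (-1)) * Y"
  have Z: "Z \<in> carrier_mat n n" using Y by (simp add: Z_def)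
  \<comment> \<open>Scaled so that the squared norms of \<open>v'\<close> and \<open>w'\<close> are
    the forms of the two means at \<open>v\<close> and \<open>w\<close>, while all powers of
    \<open>D\<close> cancel in the inner product of \<open>interp d Z d t *\<^sub>v v'\<close> with
    \<open>w'\<close>.\<close>
  define v' where "v' = rdiag n (\<lambda>i. d i powr t) *\<^sub>v (S *\<^sub>v v)"
  define w' where "w' = rdiag n (\<lambda>i. d i powr (1 - t)) *\<^sub>v (S *\<^sub>v w)"
  have v': "v' \<in> carrier_vec n" and w': "w' \<in> carrier_vec n" using S v w
    by (simp_all add: v'_def w'_def)
  have le: "nsq (interp d Z d t *\<^sub>v v') \<le> nsq v'"
  proof (rule interp_contraction[where d=d and e=d, OF Z d d _ _ t v'])
    fix u :: "complex vec" assume u: "u \<in> carrier_vec n"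
    define y where "y = Y *\<^sub>v u"
    have y: "y \<in> carrier_vec n" using Y u by (simp add: y_def)
    have "interp d Z d 0 *\<^sub>v u = rdiag n (\<lambda>i. d i powr (-1)) *\<^sub>v y"
      using Z u Y d
      by (simp add: interp_mult_vec rdiag_mult_vec_one less_imp_neq[THEN not_sym] Z_def y_def square_assoc_vec)
    then have n0: "nsq (interp d Z d 0 *\<^sub>v u) = (\<Sum>i<n. (cmod (y $ i))\<^sup>2 / c i)"
      using dm by (simp only: nsq_rdiag[OF y]) (intro sum.cong; simp)
    \<comment> \<open>The minimizer over \<open>x\<close> of
      \<open>qform (rdiag n c) x + 2 Re <y, x>\<close>; the minimum is minus the sum of the
      \<open>|y_i|^2 / c_i\<close>.\<close>
    define x where "x = rdiag n (\<lambda>i. - 1 / c i) *\<^sub>v y"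
    have x: "x \<in> carrier_vec n" using y by (simp add: x_def)
    have "Re ((Y *\<^sub>v u) \<bullet>c x) = - (\<Sum>i<n. (cmod (y $ i))\<^sup>2 / c i)"
      unfolding cscalar_prod_sum[OF x] Re_sum sum_negf[symmetric] y_def[symmetric] using y
      by (intro sum.cong) (auto simp: x_def cmod_power2 add_divide_distrib
        simp flip: power2_eq_square)
    moreover have "qform (rdiag n c) x = (\<Sum>i<n. (cmod (y $ i))\<^sup>2 / c i)"
      unfolding qform_rdiag[OF x] using y c
      by (intro sum.cong)
        (auto simp: x_def norm_mult norm_divide power_mult_distrib power_divide power2_eq_square field_simps)
    ultimately show "nsq (interp d Z d 0 *\<^sub>v u) \<le> nsq u"
      using AB[of "R *\<^sub>v u" "R *\<^sub>v x"] R u x qA[OF u] qB[OF x] XY[OF u x] n0 by simp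
    define z where "z = rdiag n (\<lambda>i. d i powr (-1)) *\<^sub>v u"
    have z: "z \<in> carrier_vec n" using u by (simp add: z_def)
    have I1: "interp d Z d 1 *\<^sub>v u = Y *\<^sub>v z"
      using Z u Y z square_cancel_vec[OF rdiag_powr_cancel(1)[where d=d and h=1, OF d], of "Y *\<^sub>v z"]
      by (simp add: interp_mult_vec Z_def z_def square_assoc_vec)
    have "qform (rdiag n c) z = nsq u"
      unfolding qform_rdiag[OF z] nsq_sum[OF u] using u c d d2
      by (intro sum.cong)
        (auto simp: z_def norm_mult norm_divide power_mult_distrib powr_minus_divide power_divide less_imp_neq[THEN not_sym])
    \<comment> \<open>Now \<open>A\<close> is the form in the second vector, and at
      \<open>R x\<close> it is \<open>nsq x\<close>, so the minimizer of
      \<open>nsq x + 2 Re <Y z, x>\<close> is \<open>- Y z\<close>.\<close>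
    moreover define x' where "x' = (-1) \<cdot>\<^sub>v (Y *\<^sub>v z)"
    have x': "x' \<in> carrier_vec n" using Y z by (simp add: x'_def)
    have "Re ((Y *\<^sub>v z) \<bullet>c x') = - nsq (Y *\<^sub>v z)"
      using Y z by (simp add: x'_def nsq_def conjugate_smult_vec)
    moreover have "nsq x' = nsq (Y *\<^sub>v z)" by (simp add: x'_def nsq_smult)
    ultimately show "nsq (interp d Z d 1 *\<^sub>v u) \<le> nsq u"
      using BA[of "R *\<^sub>v z" "R *\<^sub>v x'"] R z x' qB[OF z] qA[OF x'] XY[OF z x'] I1 by simp
  qed
  have "(interp d Z d t *\<^sub>v v') \<bullet>c w' = (Y *\<^sub>v (S *\<^sub>v v)) \<bullet>c (S *\<^sub>v w)"
  proof -
    have "interp d Z d t *\<^sub>v v' = rdiag n (\<lambda>i. d i powr t) *\<^sub>v (rdiag n (\<lambda>i. d i powr (-1)) *\<^sub>v (Y *\<^sub>v (S *\<^sub>v v)))"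
      unfolding v'_def using Z Y S v
      by (simp add: interp_mult_vec square_cancel_vec[OF rdiag_powr_cancel(2)[where d=d, OF d]] Z_def square_assoc_vec)
    also have "\<dots> = rdiag n (\<lambda>i. d i powr (-(1 - t))) *\<^sub>v (Y *\<^sub>v (S *\<^sub>v v))"
      using Y S v
      by (simp only: rdiag_mult_vec_rdiag square_mult_vec_carrier powr_add[symmetric]) (simp add: algebra_simps)
    finally show ?thesis
      using cscalar_prod_adjoint[of "rdiag n (\<lambda>i. d i powr (1 - t))" n n "interp d Z d t *\<^sub>v v'" "S *\<^sub>v w"]
        Y S v w Z v'
        square_cancel_vec[OF rdiag_powr_cancel(1)[where d=d and h="1 - t", OF d], of "Y *\<^sub>v (S *\<^sub>v v)"]
      by (simp add: w'_def)
  qed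
  also have "\<dots> = (X *\<^sub>v v) \<bullet>c w"
    using XY[of "S *\<^sub>v v" "S *\<^sub>v w"] S R v w by (simp add: square_cancel_vec[OF SR(2)])
  finally have "2 * Re ((X *\<^sub>v v) \<bullet>c w) \<le> nsq (interp d Z d t *\<^sub>v v') + nsq w'"
    using Re_cscalar_prod_le[of "interp d Z d t *\<^sub>v v'" n w' 1] Z v' w' by simp
  also have "\<dots> \<le> nsq v' + nsq w'" using le by simp
  also have "\<dots> = qform (gmean_pd t A B) v + qform (gmean_pd (1 - t) A B) w"
    unfolding G v'_def w'_def using S v w c by (simp add: qform_congruence qform_rdiag_powr d_def)
  finally show ?thesis .
qed

lemma gmean_pd_carrier:
  assumes A: "A \<in> carrier_mat n n" "pd_mat A" and B: "B \<in> carrier_mat n n" "pd_mat B"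
  shows "gmean_pd t A B \<in> carrier_mat n n"
  by (rule gmean_pd_diagonalize[OF A B]) auto

lemma gmean_pd_psd:
  assumes A: "A \<in> carrier_mat n n" "pd_mat A" and B: "B \<in> carrier_mat n n" "pd_mat B"
  shows "psd_mat (gmean_pd t A B)"
proof (rule gmean_pd_diagonalize[OF A B])
  fix S R c
  assume S: "S \<in> carrier_mat n n" and "\<And>i. i < n \<Longrightarrow> c i > 0"
    and G: "\<And>t. gmean_pd t A B = mat_adjoint S * rdiag n (\<lambda>i. c i powr t) * S"
  have Gc: "mat_adjoint S * rdiag n (\<lambda>i. c i powr t) * S \<in> carrier_mat n n" using S by simp
  show ?thesis
    unfolding G psd_mat_iff[OF Gc]
  proof (intro conjI ballI)
    show "mat_adjoint (mat_adjoint S * rdiag n (\<lambda>i. c i powr t) * S) = mat_adjoint S * rdiag n (\<lambda>i. c i powr t) * S"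
      using S by (simp add: square_adjoint_mult square_assoc)
    show "0 \<le> qform (mat_adjoint S * rdiag n (\<lambda>i. c i powr t) * S) v" if "v \<in> carrier_vec n" for v
      using S that by (auto simp: qform_congruence qform_rdiag intro!: sum_nonneg)
  qed
qed

section \<open>Semidefinite pairs: regularization and limits\<close>

definition regularize :: "complex mat \<Rightarrow> real \<Rightarrow> complex mat" where
  "regularize A \<epsilon> = A + complex_of_real \<epsilon> \<cdot>\<^sub>m 1\<^sub>m n"

lemma regularize_carrier [simp]: "A \<in> carrier_mat n n \<Longrightarrow> regularize A \<epsilon> \<in> carrier_mat n n"
  by (simp add: regularize_def)

lemma qform_regularize:
  "A \<in> carrier_mat n n \<Longrightarrow> v \<in> carrier_vec n \<Longrightarrow> qform (regularize A \<epsilon>) v = qform A v + \<epsilon> * nsq v"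
  by (simp add: regularize_def qform_add qform_smult qform_one)

lemma pd_mat_regularize:
  assumes A: "A \<in> carrier_mat n n" "psd_mat A" and \<epsilon>: "\<epsilon> > 0"
  shows "pd_mat (regularize A \<epsilon>)"
  unfolding pd_mat_iff[OF regularize_carrier[OF A(1)]]
proof (intro conjI ballI impI)
  show "mat_adjoint (regularize A \<epsilon>) = regularize A \<epsilon>"
    using A by (simp add: regularize_def psd_mat_iff mat_adjoint_add[of _ n n] mat_adjoint_smult)
  fix v :: "complex vec" assume v: "v \<in> carrier_vec n" "v \<noteq> 0\<^sub>v n"
  then show "0 < qform (regularize A \<epsilon>) v"
    using A \<epsilon> nsq_pos[OF v] by (auto simp: qform_regularize psd_mat_iff intro!: add_nonneg_pos)
qed

text \<open>Monotonicity gives convergence of quadratic forms only. Polarization carries it over to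
  the entries, which is where \<open>gmean\<close> takes its limit.\<close>

lemma qform_polarization:
  assumes A: "A \<in> carrier_mat n n" "mat_adjoint A = A"
    and x: "x \<in> carrier_vec n" and y: "y \<in> carrier_vec n"
  shows "4 * ((A *\<^sub>v x) \<bullet>c y) = complex_of_real (qform A (x + y) - qform A (x - y)) +
    \<i> * complex_of_real (qform A (x + \<i> \<cdot>\<^sub>v y) - qform A (x - \<i> \<cdot>\<^sub>v y))"
proof -
  have sym: "(A *\<^sub>v y) \<bullet>c x = cnj ((A *\<^sub>v x) \<bullet>c y)"
    using cscalar_prod_adjoint[OF A(1) y x] A x y by (simp add: cscalar_prod_commute[of y n])
  have re: "qform A (x + z) - qform A (x - z) = 2 * Re ((A *\<^sub>v x) \<bullet>c z) + 2 * Re ((A *\<^sub>v z) \<bullet>c x)"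
    if z: "z \<in> carrier_vec n" for z
  proof -
    have *: "(p + r) \<bullet>c (x + z) - (p - r) \<bullet>c (x - z) = 2 * (p \<bullet>c z) + 2 * (r \<bullet>c x)"
      if "p \<in> carrier_vec n" "r \<in> carrier_vec n" for p r
      unfolding cscalar_prod_sum[OF x] cscalar_prod_sum[OF z] cscalar_prod_sum[OF add_carrier_vec[OF x z]]
        cscalar_prod_sum[OF minus_carrier_vec[OF x z]] sum_subtractf[symmetric] sum_distrib_left sum.distrib[symmetric]
      using that x z by (intro sum.cong) (auto simp: algebra_simps)
    from arg_cong[OF *[of "A *\<^sub>v x" "A *\<^sub>v z"], of Re] show ?thesis
      using A x z
        by (simp add: qform_def mult_add_distrib_mat_vec[of _ n n] mult_minus_distrib_mat_vec[of _ n n])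
  qed
  have iy: "\<i> \<cdot>\<^sub>v y \<in> carrier_vec n" using y by simp
  have A1: "(A *\<^sub>v x) \<bullet>c (\<i> \<cdot>\<^sub>v y) = - \<i> * ((A *\<^sub>v x) \<bullet>c y)"
    using A x y by (simp add: conjugate_smult_vec)
  have A2: "(A *\<^sub>v (\<i> \<cdot>\<^sub>v y)) \<bullet>c x = \<i> * ((A *\<^sub>v y) \<bullet>c x)"
    using A x y by (simp add: mult_mat_vec[of _ n n])
  show ?thesis
    unfolding re[OF y] re[OF iy] A1 A2 sym by (simp add: complex_eq_iff)
qed

lemma mult_mat_unit_vec:
  fixes A :: "complex mat"
  shows "A \<in> carrier_mat n n \<Longrightarrow> j < n \<Longrightarrow> A *\<^sub>v unit_vec n j = col A j"
  by (metis col_mult2 col_one one_carrier_mat right_mult_one_mat)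

lemma unit_vec_sandwich:
  fixes A :: "complex mat"
  assumes A: "A \<in> carrier_mat n n" and i: "i < n" and j: "j < n"
  shows "(A *\<^sub>v unit_vec n j) \<bullet>c unit_vec n i = A $$ (i, j)"
proof -
  have "conjugate (unit_vec n i) = (unit_vec n i :: complex vec)"
    using i by (intro eq_vecI) (auto simp: unit_vec_def)
  moreover have "A *\<^sub>v unit_vec n j = col A j" using A j by (rule mult_mat_unit_vec)
  ultimately show ?thesis using A i j by simp
qed

lemma tendsto_qform:
  assumes "\<And>i j. i < n \<Longrightarrow> j < n \<Longrightarrow> ((\<lambda>\<epsilon>. G \<epsilon> $$ (i, j)) \<longlongrightarrow> L $$ (i, j)) F"
    and G: "\<forall>\<^sub>F \<epsilon> in F. G \<epsilon> \<in> carrier_mat n n" and L: "L \<in> carrier_mat n n"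
      and v: "v \<in> carrier_vec n"
  shows "((\<lambda>\<epsilon>. qform (G \<epsilon>) v) \<longlongrightarrow> qform L v) F"
proof -
  have eq: "qform M v = Re (\<Sum>i<n. (\<Sum>j<n. M $$ (i, j) * v $ j) * cnj (v $ i))"
    if "M \<in> carrier_mat n n" for M
    using that v by (auto simp: qform_def cscalar_prod_sum[of _ n] scalar_prod_def lessThan_atLeast0
      intro!: sum.cong arg_cong[of _ _ Re])
  have "((\<lambda>\<epsilon>. Re (\<Sum>i<n. (\<Sum>j<n. G \<epsilon> $$ (i, j) * v $ j) * cnj (v $ i))) \<longlongrightarrow> qform L v) F"
    unfolding eq[OF L] using assms(1) by (intro tendsto_intros) auto
  moreover have "\<forall>\<^sub>F \<epsilon> in F. Re (\<Sum>i<n. (\<Sum>j<n. G \<epsilon> $$ (i, j) * v $ j) * cnj (v $ i)) = qform (G \<epsilon>) v"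
    using G by eventually_elim (simp add: eq)
  ultimately show ?thesis by (rule Lim_transform_eventually)
qed

text \<open>\<open>Lim\<close> is a definite description, so the claim amounts to convergence. By
  \<open>gmean_pd_mono\<close> the quadratic forms are monotone in \<epsilon>, and they are bounded
  below by 0.\<close>

lemma gmean_tendsto_entry:
  assumes A: "A \<in> carrier_mat n n" "psd_mat A" and B: "B \<in> carrier_mat n n" "psd_mat B"
    and t: "0 \<le> t" "t \<le> 1" and i: "i < n" and j: "j < n"
  defines "G \<equiv> \<lambda>\<epsilon>. gmean_pd t (regularize A \<epsilon>) (regularize B \<epsilon>)"
  shows "((\<lambda>\<epsilon>. G \<epsilon> $$ (i, j)) \<longlongrightarrow> Lim (at_right 0) (\<lambda>\<epsilon>. G \<epsilon> $$ (i, j))) (at_right 0)"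
proof -
  have reg: "regularize A \<epsilon> \<in> carrier_mat n n" "regularize B \<epsilon> \<in> carrier_mat n n" for \<epsilon>
    using A B by simp_all
  note pd = pd_mat_regularize[OF A] pd_mat_regularize[OF B]
  have Gc: "G \<epsilon> \<in> carrier_mat n n" and Gpsd: "psd_mat (G \<epsilon>)" if "\<epsilon> > 0" for \<epsilon>
    unfolding G_def using reg pd[OF that] by (simp_all add: gmean_pd_carrier gmean_pd_psd)
  have "\<exists>l. ((\<lambda>\<epsilon>. qform (G \<epsilon>) v) \<longlongrightarrow> l) (at_right 0)" if v: "v \<in> carrier_vec n" for v
  proof (rule mono_tendsto_at_right)
    fix x y :: real assume xy: "0 < x" "x \<le> y"
    then have "0 < y" by simp
    show "qform (G x) v \<le> qform (G y) v"
      unfolding G_def using xy A B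
      by (intro gmean_pd_mono reg pd t v \<open>0 < x\<close> \<open>0 < y\<close>) (auto simp: qform_regularize
        intro!: mult_right_mono)
  next
    fix x :: real assume "0 < x"
    then show "0 \<le> qform (G x) v" using Gpsd Gc v by (auto simp: psd_mat_iff)
  qed
  then obtain q where q: "\<And>v. v \<in> carrier_vec n \<Longrightarrow> ((\<lambda>\<epsilon>. qform (G \<epsilon>) v) \<longlongrightarrow> q v) (at_right 0)"
    by metis
  \<comment> \<open>In this order, since the inner product of \<open>G \<epsilon>\<close> applied to
    the unit vector at \<open>j\<close> with the unit vector at \<open>i\<close> is entry
    \<open>(i, j)\<close>. The number \<open>l\<close> is then the polarization identity written
    with the limits \<open>q\<close>.\<close>
  define x where "x = (unit_vec n j :: complex vec)"
  define y where "y = (unit_vec n i :: complex vec)"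
  have xy: "x \<in> carrier_vec n" "y \<in> carrier_vec n" by (simp_all add: x_def y_def)
  define l where "l = (complex_of_real (q (x + y) - q (x - y)) +
      \<i> * complex_of_real (q (x + \<i> \<cdot>\<^sub>v y) - q (x - \<i> \<cdot>\<^sub>v y))) / 4"
  have "((\<lambda>\<epsilon>. (complex_of_real (qform (G \<epsilon>) (x + y) - qform (G \<epsilon>) (x - y)) +
      \<i> * complex_of_real (qform (G \<epsilon>) (x + \<i> \<cdot>\<^sub>v y) - qform (G \<epsilon>) (x - \<i> \<cdot>\<^sub>v y))) / 4) \<longlongrightarrow> l) (at_right 0)"
    unfolding l_def using xy by (intro tendsto_intros q) auto
  moreover have "\<forall>\<^sub>F \<epsilon> in at_right 0. (complex_of_real (qform (G \<epsilon>) (x + y) - qform (G \<epsilon>) (x - y)) +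
      \<i> * complex_of_real (qform (G \<epsilon>) (x + \<i> \<cdot>\<^sub>v y) - qform (G \<epsilon>) (x - \<i> \<cdot>\<^sub>v y))) / 4 = G \<epsilon> $$ (i, j)"
    unfolding eventually_at_right_field
  proof (intro exI[of _ 1] conjI allI impI)
    fix \<epsilon> :: real assume \<epsilon>: "0 < \<epsilon>"
    have "mat_adjoint (G \<epsilon>) = G \<epsilon>" using Gpsd[OF \<epsilon>] Gc[OF \<epsilon>] by (simp add: psd_mat_iff)
    from qform_polarization[OF Gc[OF \<epsilon>] this xy]
    show "(complex_of_real (qform (G \<epsilon>) (x + y) - qform (G \<epsilon>) (x - y)) +
      \<i> * complex_of_real (qform (G \<epsilon>) (x + \<i> \<cdot>\<^sub>v y) - qform (G \<epsilon>) (x - \<i> \<cdot>\<^sub>v y))) / 4 = G \<epsilon> $$ (i, j)"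
      unfolding x_def y_def unit_vec_sandwich[OF Gc[OF \<epsilon>] i j]
      by (metis nonzero_mult_div_cancel_left zero_neq_numeral)
  qed simp
  ultimately have "((\<lambda>\<epsilon>. G \<epsilon> $$ (i, j)) \<longlongrightarrow> l) (at_right 0)"
    by (rule Lim_transform_eventually)
  then show ?thesis
    using tendsto_Lim[OF trivial_limit_at_right_real] by metis
qed

lemma gmean_carrier:
  assumes A: "A \<in> carrier_mat n n" and B: "B \<in> carrier_mat n n"
  shows "gmean t A B \<in> carrier_mat n n"
  unfolding gmean_def using A gmean_pd_carrier[OF A _ B] by auto

text \<open>On positive definite pairs \<open>gmean\<close> is the closed formula, so the results
  below split into two cases instead of proving continuity of that formula at \<epsilon> =
  0.\<close>

lemma gmean_tendsto:
  assumes A: "A \<in> carrier_mat n n" "psd_mat A" and B: "B \<in> carrier_mat n n" "psd_mat B"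
    and t: "0 \<le> t" "t \<le> 1" and npd: "\<not> (pd_mat A \<and> pd_mat B)"
  shows "i < n \<Longrightarrow> j < n \<Longrightarrow>
      ((\<lambda>\<epsilon>. gmean_pd t (regularize A \<epsilon>) (regularize B \<epsilon>) $$ (i, j)) \<longlongrightarrow> gmean t A B $$ (i, j)) (at_right 0)"
    and "v \<in> carrier_vec n \<Longrightarrow>
      ((\<lambda>\<epsilon>. qform (gmean_pd t (regularize A \<epsilon>) (regularize B \<epsilon>)) v) \<longlongrightarrow> qform (gmean t A B) v) (at_right 0)"
proof -
  have dim: "dim_row A = n" using A by simp
  show *: "((\<lambda>\<epsilon>. gmean_pd t (regularize A \<epsilon>) (regularize B \<epsilon>) $$ (i, j)) \<longlongrightarrow> gmean t A B $$ (i, j)) (at_right 0)"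
    if "i < n" "j < n" for i j
    using gmean_tendsto_entry[OF A B t that] npd that
    by (auto simp: gmean_def dim regularize_def)
  show "((\<lambda>\<epsilon>. qform (gmean_pd t (regularize A \<epsilon>) (regularize B \<epsilon>)) v) \<longlongrightarrow> qform (gmean t A B) v) (at_right 0)"
    if "v \<in> carrier_vec n" for v
  proof (rule tendsto_qform[OF * _ gmean_carrier[OF A(1) B(1)] that])
    show "\<forall>\<^sub>F \<epsilon> in at_right 0. gmean_pd t (regularize A \<epsilon>) (regularize B \<epsilon>) \<in> carrier_mat n n"
      unfolding eventually_at_right_field
      using gmean_pd_carrier pd_mat_regularize[OF A] pd_mat_regularize[OF B] A B
        by (intro exI[of _ 1]) auto
  qed
qed

lemma gmean_psd:
  assumes A: "A \<in> carrier_mat n n" "psd_mat A" and B: "B \<in> carrier_mat n n" "psd_mat B"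
    and t: "0 \<le> t" "t \<le> 1"
  shows "psd_mat (gmean t A B)"
proof (cases "pd_mat A \<and> pd_mat B")
  case True
  then show ?thesis using gmean_pd_psd A B by (simp add: gmean_def)
next
  case False
  note lim = gmean_tendsto[OF A B t False]
  note Gc = gmean_carrier[OF A(1) B(1), of t]
  have psd: "psd_mat (gmean_pd t (regularize A \<epsilon>) (regularize B \<epsilon>))"
    and c: "gmean_pd t (regularize A \<epsilon>) (regularize B \<epsilon>) \<in> carrier_mat n n" if "\<epsilon> > 0" for \<epsilon>
    using A B pd_mat_regularize[OF A that] pd_mat_regularize[OF B that]
      by (simp_all add: gmean_pd_psd gmean_pd_carrier)
  have pos: "\<forall>\<^sub>F \<epsilon> in at_right (0::real). \<epsilon> > 0"
    unfolding eventually_at_right_field by (intro exI[of _ 1]) auto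
  show ?thesis
    unfolding psd_mat_iff[OF Gc]
  proof (intro conjI ballI)
    show "mat_adjoint (gmean t A B) = gmean t A B"
    proof (rule eq_matI)
      fix i j assume "i < dim_row (gmean t A B)" "j < dim_col (gmean t A B)"
      then have ij: "i < n" "j < n" using Gc by auto
      have "((\<lambda>\<epsilon>. cnj (gmean_pd t (regularize A \<epsilon>) (regularize B \<epsilon>) $$ (j, i))) \<longlongrightarrow> cnj (gmean t A B $$ (j, i))) (at_right 0)"
        by (intro tendsto_cnj lim ij)
      moreover have "\<forall>\<^sub>F \<epsilon> in at_right 0. cnj (gmean_pd t (regularize A \<epsilon>) (regularize B \<epsilon>) $$ (j, i)) =
          gmean_pd t (regularize A \<epsilon>) (regularize B \<epsilon>) $$ (i, j)"
        using pos
      proof eventually_elim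
        case (elim \<epsilon>)
        then have "mat_adjoint (gmean_pd t (regularize A \<epsilon>) (regularize B \<epsilon>)) = gmean_pd t (regularize A \<epsilon>) (regularize B \<epsilon>)"
          using psd[OF elim] c[OF elim] by (simp add: psd_mat_iff)
        from arg_cong[OF this, of "\<lambda>M. M $$ (i, j)"] show ?case
          using c[OF elim] ij by simp
      qed
      ultimately have "((\<lambda>\<epsilon>. gmean_pd t (regularize A \<epsilon>) (regularize B \<epsilon>) $$ (i, j)) \<longlongrightarrow> cnj (gmean t A B $$ (j, i))) (at_right 0)"
        by (rule Lim_transform_eventually)
      with lim(1)[OF ij] have "gmean t A B $$ (i, j) = cnj (gmean t A B $$ (j, i))"
        using tendsto_unique[OF trivial_limit_at_right_real] by blast
      then show "mat_adjoint (gmean t A B) $$ (i, j) = gmean t A B $$ (i, j)"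
        using Gc ij by simp
    qed (use Gc in auto)
    fix v :: "complex vec" assume v: "v \<in> carrier_vec n"
    show "0 \<le> qform (gmean t A B) v"
    proof (rule tendsto_lowerbound[OF lim(2)[OF v]])
      show "\<forall>\<^sub>F \<epsilon> in at_right 0. 0 \<le> qform (gmean_pd t (regularize A \<epsilon>) (regularize B \<epsilon>)) v"
        using pos by eventually_elim (use psd c v in \<open>auto simp: psd_mat_iff\<close>)
    qed simp
  qed
qed

text \<open>Adding a positive multiple of the identity to both diagonal blocks preserves both block
  conditions. The definite case therefore applies to the regularized pair, and a non-strict
  inequality survives the limit.\<close>

lemma ppt_gmean:
  assumes A: "A \<in> carrier_mat n n" "psd_mat A" and B: "B \<in> carrier_mat n n" "psd_mat B"
    and X: "X \<in> carrier_mat n n"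
    and AB: "\<And>v w. v \<in> carrier_vec n \<Longrightarrow> w \<in> carrier_vec n \<Longrightarrow>
      0 \<le> qform A v + 2 * Re ((X *\<^sub>v v) \<bullet>c w) + qform B w"
    and BA: "\<And>v w. v \<in> carrier_vec n \<Longrightarrow> w \<in> carrier_vec n \<Longrightarrow>
      0 \<le> qform B v + 2 * Re ((X *\<^sub>v v) \<bullet>c w) + qform A w"
    and t: "0 \<le> t" "t \<le> 1" and v: "v \<in> carrier_vec n" and w: "w \<in> carrier_vec n"
  shows "2 * Re ((X *\<^sub>v v) \<bullet>c w) \<le> qform (gmean t A B) v + qform (gmean (1 - t) A B) w"
proof (cases "pd_mat A \<and> pd_mat B")
  case True
  then show ?thesis using ppt_gmean_pd[OF A(1) _ B(1) _ X AB BA t v w] by (simp add: gmean_def)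
next
  case False
  have t': "0 \<le> 1 - t" "1 - t \<le> 1" using t by auto
  define G where "G s \<epsilon> = gmean_pd s (regularize A \<epsilon>) (regularize B \<epsilon>)" for s \<epsilon>
  have lim: "((\<lambda>\<epsilon>. qform (G t \<epsilon>) v + qform (G (1 - t) \<epsilon>) w) \<longlongrightarrow>
      qform (gmean t A B) v + qform (gmean (1 - t) A B) w) (at_right 0)"
    unfolding G_def by (intro tendsto_add gmean_tendsto A B t t' False v w)
  show ?thesis
  proof (rule tendsto_lowerbound[OF lim])
    show "\<forall>\<^sub>F \<epsilon> in at_right 0. 2 * Re ((X *\<^sub>v v) \<bullet>c w) \<le> qform (G t \<epsilon>) v + qform (G (1 - t) \<epsilon>) w"
      unfolding eventually_at_right_field
    proof (intro exI[of _ 1] conjI allI impI)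
      fix \<epsilon> :: real assume \<epsilon>: "0 < \<epsilon>"
      have le: "0 \<le> \<epsilon> * nsq x" for x using \<epsilon> by simp
      show "2 * Re ((X *\<^sub>v v) \<bullet>c w) \<le> qform (G t \<epsilon>) v + qform (G (1 - t) \<epsilon>) w"
        unfolding G_def
      proof (rule ppt_gmean_pd[OF _ _ _ _ X _ _ t v w])
        fix x y :: "complex vec" assume "x \<in> carrier_vec n" "y \<in> carrier_vec n"
        then show "0 \<le> qform (regularize A \<epsilon>) x + 2 * Re ((X *\<^sub>v x) \<bullet>c y) + qform (regularize B \<epsilon>) y"
          "0 \<le> qform (regularize B \<epsilon>) x + 2 * Re ((X *\<^sub>v x) \<bullet>c y) + qform (regularize A \<epsilon>) y"
          using AB[of x y] BA[of x y] A B le[of x] le[of y] by (simp_all add: qform_regularize)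
      qed (use A B \<epsilon> pd_mat_regularize in auto)
    qed simp
  qed simp
qed

section \<open>Polar decomposition and comparison of eigenvalues\<close>

lemma psd_block_qform:
  assumes A: "A \<in> carrier_mat n n" and B: "B \<in> carrier_mat n n" and X: "X \<in> carrier_mat n n"
    and psd: "psd_mat (four_block_mat A (mat_adjoint X) X B)"
    and v: "v \<in> carrier_vec n" and w: "w \<in> carrier_vec n"
  shows "0 \<le> qform A v + 2 * Re ((X *\<^sub>v v) \<bullet>c w) + qform B w"
proof -
  have M: "four_block_mat A (mat_adjoint X) X B \<in> carrier_mat (n + n) (n + n)"
    using A B X by simp
  have vw: "v @\<^sub>v w \<in> carrier_vec (n + n)" using v w by simp
  have "0 \<le> Re ((four_block_mat A (mat_adjoint X) X B *\<^sub>v (v @\<^sub>v w)) \<bullet>c (v @\<^sub>v w))"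
    using psd M vw by (auto simp: psd_mat_def)
  also have "four_block_mat A (mat_adjoint X) X B *\<^sub>v (v @\<^sub>v w) =
      (A *\<^sub>v v + mat_adjoint X *\<^sub>v w) @\<^sub>v (X *\<^sub>v v + B *\<^sub>v w)"
    using A B X v w by (intro four_block_mat_mult_vec) auto
  also have "conjugate (v @\<^sub>v w) = conjugate v @\<^sub>v conjugate w"
    by (intro eq_vecI) auto
  also have "((A *\<^sub>v v + mat_adjoint X *\<^sub>v w) @\<^sub>v (X *\<^sub>v v + B *\<^sub>v w)) \<bullet> (conjugate v @\<^sub>v conjugate w) =
      (A *\<^sub>v v + mat_adjoint X *\<^sub>v w) \<bullet>c v + (X *\<^sub>v v + B *\<^sub>v w) \<bullet>c w"
    using A B X v w by (intro scalar_prod_append[of _ n _ n]) auto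
  also have "\<dots> = (A *\<^sub>v v) \<bullet>c v + (mat_adjoint X *\<^sub>v w) \<bullet>c v + ((X *\<^sub>v v) \<bullet>c w + (B *\<^sub>v w) \<bullet>c w)"
    using A B X v w by (simp add: add_scalar_prod_distrib[of _ n])
  also have "(mat_adjoint X *\<^sub>v w) \<bullet>c v = cnj ((X *\<^sub>v v) \<bullet>c w)"
    using X v w cscalar_prod_adjoint[OF X v w] by (simp add: cscalar_prod_commute[of v n])
  finally show ?thesis by (simp add: qform_def)
qed

lemma psd_block_diagonal:
  assumes A: "A \<in> carrier_mat n n" and B: "B \<in> carrier_mat n n" and X: "X \<in> carrier_mat n n"
    and psd: "psd_mat (four_block_mat A (mat_adjoint X) X B)"
  shows "psd_mat A" "psd_mat B"
proof -
  have "mat_adjoint (four_block_mat A (mat_adjoint X) X B) = four_block_mat A (mat_adjoint X) X B"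
    using psd by (auto simp: psd_mat_def hermitian_mat_def)
  then have eq: "four_block_mat (mat_adjoint A) (mat_adjoint X) X (mat_adjoint B) = four_block_mat A (mat_adjoint X) X B"
    using A B X by (simp add: mat_adjoint_four_block[of _ n _ n])
  have "mat_adjoint A = A"
  proof (rule eq_matI)
    fix i j assume "i < dim_row A" "j < dim_col A"
    then show "mat_adjoint A $$ (i, j) = A $$ (i, j)"
      using arg_cong[OF eq, of "\<lambda>M. M $$ (i, j)"] A B X by simp
  qed (use A in auto)
  moreover have "mat_adjoint B = B"
  proof (rule eq_matI)
    fix i j assume "i < dim_row B" "j < dim_col B"
    then show "mat_adjoint B $$ (i, j) = B $$ (i, j)"
      using arg_cong[OF eq, of "\<lambda>M. M $$ (n + i, n + j)"] A B X by simp
  qed (use B in auto)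
  moreover have "qform A v \<ge> 0" "qform B v \<ge> 0" if v: "v \<in> carrier_vec n" for v
    using psd_block_qform[OF A B X psd v zero_carrier_vec] psd_block_qform[OF A B X psd zero_carrier_vec v]
      A B X v mult_mat_zero_vec[of _ n n]
    by (simp_all add: qform_def)
  ultimately show "psd_mat A" "psd_mat B"
    using A B by (simp_all add: psd_mat_iff)
qed

text \<open>\<open>W\<close> is the partial isometry of the polar decomposition.\<close>

lemma mat_abs_polar:
  assumes X: "X \<in> carrier_mat n n"
  obtains W where "W \<in> carrier_mat n n" "\<And>v. v \<in> carrier_vec n \<Longrightarrow> nsq (W *\<^sub>v v) \<le> nsq v"
    "mat_abs X \<in> carrier_mat n n" "psd_mat (mat_abs X)"
    "\<And>v. v \<in> carrier_vec n \<Longrightarrow> qform (mat_abs X) v = Re ((X *\<^sub>v v) \<bullet>c (W *\<^sub>v v))"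
proof -
  have H: "mat_adjoint X * X \<in> carrier_mat n n" "psd_mat (mat_adjoint X * X)"
    using X by (auto simp: psd_mat_iff square_adjoint_mult qform_adjoint_mult)
  obtain U d where U: "U \<in> carrier_mat n n" "mat_adjoint U * U = 1\<^sub>m n"
    and XX: "mat_adjoint X * X = U * rdiag n d * mat_adjoint U" and d: "\<And>i. i < n \<Longrightarrow> d i \<ge> 0"
    using psd_mat_spectral[OF H] by blast
  note UU = unitary_mat_right_inverse[OF U]
  define s where "s = (\<lambda>i. d i powr (1/2))"
  \<comment> \<open>As \<open>inverse 0 = 0\<close>, this yields the pseudoinverse of
    \<open>|X|\<close>: \<open>W\<close> vanishes on the kernel of \<open>X\<close>, each
    \<open>d i * r i * r i\<close> is 1 or 0, and \<open>r i * d i = s i\<close> holds at zero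
    eigenvalues too.\<close>
  define r where "r = (\<lambda>i. inverse (s i))"
  have sd: "s i * s i = d i" if "i < n" for i
    using d[OF that] by (simp add: s_def flip: powr_add)
  have abs: "mat_abs X = U * rdiag n s * mat_adjoint U"
    unfolding mat_abs_def mat_powr_def s_def by (rule mat_fun_eq[OF U XX])
  have absc: "mat_abs X \<in> carrier_mat n n" unfolding abs using U by simp
  define W where "W = X * (U * rdiag n r * mat_adjoint U)"
  have W: "W \<in> carrier_mat n n" using X U by (simp add: W_def)
  have Wv: "nsq (W *\<^sub>v v) \<le> nsq v" if v: "v \<in> carrier_vec n" for v
  proof -
    define y where "y = mat_adjoint U *\<^sub>v v"
    have y: "y \<in> carrier_vec n" using U v by (simp add: y_def)
    have "nsq (W *\<^sub>v v) = qform (mat_adjoint X * X) (U *\<^sub>v (rdiag n r *\<^sub>v y))"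
      using X U v by (simp add: W_def y_def qform_adjoint_mult square_assoc_vec)
    also have "\<dots> = qform (rdiag n d) (rdiag n r *\<^sub>v y)"
      unfolding XX using U y qform_congruence[of "mat_adjoint U" "rdiag n d" "U *\<^sub>v (rdiag n r *\<^sub>v y)"]
      by (simp add: square_cancel_vec[OF U(2)])
    also have "\<dots> = (\<Sum>i<n. d i * (r i)\<^sup>2 * (cmod (y $ i))\<^sup>2)"
      using y by (simp add: qform_rdiag norm_mult power_mult_distrib mult.assoc)
    also have "\<dots> \<le> (\<Sum>i<n. (cmod (y $ i))\<^sup>2)"
    proof (intro sum_mono)
      fix i assume "i \<in> {..<n}"
      then have "d i * (r i)\<^sup>2 \<le> 1"
        using sd[of i] by (auto simp: r_def power2_eq_square field_simps)
      then show "d i * (r i)\<^sup>2 * (cmod (y $ i))\<^sup>2 \<le> (cmod (y $ i))\<^sup>2"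
        using mult_right_mono[of "d i * (r i)\<^sup>2" 1 "(cmod (y $ i))\<^sup>2"] by simp
    qed
    also have "\<dots> = nsq y" using y by (simp add: nsq_sum)
    also have "\<dots> = nsq v"
      unfolding y_def using U UU v by (intro nsq_unitary) auto
    finally show ?thesis .
  qed
  have psd: "psd_mat (mat_abs X)"
    unfolding psd_mat_iff[OF absc]
  proof (intro conjI ballI)
    show "mat_adjoint (mat_abs X) = mat_abs X"
      unfolding abs using U by (simp add: square_adjoint_mult square_assoc)
    show "0 \<le> qform (mat_abs X) v" if "v \<in> carrier_vec n" for v
      unfolding abs qform_spectral[OF U(1) that] by (auto simp: s_def intro!: sum_nonneg)
  qed
  have polar: "qform (mat_abs X) v = Re ((X *\<^sub>v v) \<bullet>c (W *\<^sub>v v))" if v: "v \<in> carrier_vec n" for v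
  proof -
    have "mat_adjoint W * X = U * rdiag n r * mat_adjoint U * (mat_adjoint X * X)"
      using X U by (simp add: W_def square_adjoint_mult square_assoc)
    also have "\<dots> = U * (rdiag n r * rdiag n d) * mat_adjoint U"
      unfolding XX using U by (simp add: square_assoc square_cancel[OF U(2)])
    also have "rdiag n r * rdiag n d = rdiag n s"
      unfolding rdiag_mult
    proof (rule rdiag_cong)
      show "r i * d i = s i" if "i < n" for i
        unfolding sd[OF that, symmetric] r_def by (cases "s i = 0") auto
    qed
    finally have WX: "mat_adjoint W * X = mat_abs X" unfolding abs .
    show ?thesis
      unfolding WX[symmetric] using W X v cscalar_prod_adjoint[of "mat_adjoint W" n n "X *\<^sub>v v" v]
      by (simp add: qform_def square_assoc_vec)
  qed
  show ?thesis
    by (rule that[of W]) (fact W Wv absc psd polar)+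
qed

text \<open>The conditions are \<open>n - card I + card K < n\<close> homogeneous linear equations.
  Padding them with zero rows gives a square matrix whose last row is zero, hence of determinant
  zero and with a nontrivial kernel.\<close>

lemma exists_nonzero_vec_vanishing:
  fixes M :: "complex mat"
  assumes M: "M \<in> carrier_mat n n" and I: "I \<subseteq> {..<n}" and K: "K \<subseteq> {..<n}"
    and card: "card K < card I"
  obtains x where "x \<in> carrier_vec n" "x \<noteq> 0\<^sub>v n"
    "\<And>i. i < n \<Longrightarrow> i \<notin> I \<Longrightarrow> x $ i = 0" "\<And>k. k \<in> K \<Longrightarrow> (M *\<^sub>v x) $ k = 0"
proof -
  have fin: "finite I" "finite K" using I K finite_subset by blast+
  define rs where "rs = map (unit_vec n) (sorted_list_of_set ({..<n} - I)) @ map (row M) (sorted_list_of_set K)"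
  have len: "length rs = (n - card I) + card K"
    using fin I K by (simp add: rs_def card_Diff_subset)
  have "card I \<le> n" using card_mono[OF _ I] by simp
  then have less: "length rs < n" using len card by simp
  define rs' where "rs' = rs @ replicate (n - length rs) (0\<^sub>v n)"
  have len': "length rs' = n" using less by (simp add: rs'_def)
  have rsc: "set rs' \<subseteq> carrier_vec n"
    using M K fin by (auto simp: rs'_def rs_def)
  define N where "N = mat_of_rows n rs'"
  have N: "N \<in> carrier_mat n n" using len' by (simp add: N_def mat_of_rows_def)
  have rowN: "row N i = rs' ! i" if "i < n" for i
    using that rsc len' unfolding N_def by (intro mat_of_rows_row) auto
  have "det N = 0"
  proof -
    have "row N (n - 1) = 0\<^sub>v n"
      using less rowN[of "n - 1"] by (auto simp: rs'_def nth_append)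
    then have "transpose_mat N *\<^sub>v unit_vec n (n - 1) = 0\<^sub>v n"
      using N less by (simp add: mult_mat_unit_vec)
    moreover have "unit_vec n (n - 1) \<noteq> (0\<^sub>v n :: complex vec)"
      using less by (auto dest: arg_cong[of _ _ "\<lambda>v. v $ (n - 1)"])
    ultimately have "det (transpose_mat N) = 0"
      using N by (subst det_0_iff_vec_prod_zero[of _ n]) (auto
        intro!: exI[of _ "unit_vec n (n - 1)"])
    then show ?thesis using det_transpose[OF N] by simp
  qed
  then obtain x where x: "x \<in> carrier_vec n" "x \<noteq> 0\<^sub>v n" and Nx: "N *\<^sub>v x = 0\<^sub>v n"
    using det_0_iff_vec_prod_zero[OF N] by auto
  have vanish: "r \<bullet> x = 0" if r: "r \<in> set rs" for r
  proof -
    obtain i where i: "i < length rs" "rs ! i = r" using r by (metis in_set_conv_nth)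
    then have "rs' ! i = r" "i < n" using less by (simp_all add: rs'_def nth_append)
    then show ?thesis
      using arg_cong[OF Nx, of "\<lambda>v. v $ i"] N rowN by simp
  qed
  show ?thesis
  proof (rule that[OF x])
    show "x $ i = 0" if "i < n" "i \<notin> I" for i
      using vanish[of "unit_vec n i"] that x by (auto simp: rs_def)
    show "(M *\<^sub>v x) $ k = 0" if "k \<in> K" for k
      using vanish[of "row M k"] that M K fin by (auto simp: rs_def)
  qed
qed

text \<open>Unitary similarity preserves the characteristic polynomial, and that of a diagonal
  matrix is already a product of linear factors, so its roots with multiplicity are the diagonal
  entries.\<close>

lemma eig_desc_spectral:
  assumes U: "U \<in> carrier_mat n n" "mat_adjoint U * U = 1\<^sub>m n"
    and H: "H = U * rdiag n d * mat_adjoint U"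
  shows "eig_desc j H = rev (sort (map d [0..<n])) ! (j - 1)"
proof -
  have proots: "proots (\<Prod>i\<leftarrow>js. [:- f i, 1:]) = mset (map f js)" for f :: "nat \<Rightarrow> complex" and js
  proof (induction js)
    case (Cons a js)
    have "(\<Prod>i\<leftarrow>js. [:- f i, 1:]) \<noteq> 0" by (auto simp: prod_list_zero_iff)
    with Cons show ?case by (simp add: proots_mult del: mult_pCons_left)
  qed simp
  have Hc: "H \<in> carrier_mat n n" using U H by simp
  have "similar_mat_wit H (rdiag n d) U (mat_adjoint U)"
    using U Hc unitary_mat_right_inverse[OF U] H by (intro similar_mat_witI[of _ _ n]) auto
  then have "char_poly H = char_poly (rdiag n d)"
    by (intro char_poly_similar) (auto simp: similar_mat_def)
  also have "\<dots> = (\<Prod>a\<leftarrow>diag_mat (rdiag n d). [:- a, 1:])"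
    by (intro char_poly_upper_triangular[of _ n]) auto
  also have "diag_mat (rdiag n d) = map (\<lambda>i. complex_of_real (d i)) [0..<n]"
    by (auto simp: diag_mat_def)
  finally have "char_poly H = (\<Prod>i\<leftarrow>[0..<n]. [:- complex_of_real (d i), 1:])"
    by (simp add: o_def)
  then have "proots (char_poly H) = mset (map (\<lambda>i. complex_of_real (d i)) [0..<n])"
    by (simp only: proots)
  then have "image_mset Re (proots (char_poly H)) = mset (map d [0..<n])"
    by (simp add: multiset.map_comp o_def flip: mset_map)
  then show ?thesis
    unfolding eig_desc_def by (simp only: sorted_list_of_multiset_mset)
qed

text \<open>Comparing eigenvalues through a contraction requires \<open>G\<close> to be positive semidefinite:
  where \<open>W\<close> shrinks a vector, only a nonnegative form is controlled.\<close>

lemma eig_desc_le: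
  assumes H: "H \<in> carrier_mat n n" "mat_adjoint H = H" and G: "G \<in> carrier_mat n n" "psd_mat G"
    and W: "W \<in> carrier_mat n n" "\<And>v. v \<in> carrier_vec n \<Longrightarrow> nsq (W *\<^sub>v v) \<le> nsq v"
    and le: "\<And>v. v \<in> carrier_vec n \<Longrightarrow> qform H v \<le> qform G (W *\<^sub>v v)"
    and j: "j \<in> {1..n}"
  shows "eig_desc j H \<le> eig_desc j G"
proof (rule ccontr)
  assume contr: "\<not> eig_desc j H \<le> eig_desc j G"
  define c where "c = eig_desc j H"
  obtain U a where U: "U \<in> carrier_mat n n" "mat_adjoint U * U = 1\<^sub>m n"
    and Heq: "H = U * rdiag n a * mat_adjoint U"
    using hermitian_spectral[OF H] by blast
  obtain V b where V: "V \<in> carrier_mat n n" "mat_adjoint V * V = 1\<^sub>m n"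
    and Geq: "G = V * rdiag n b * mat_adjoint V" and b: "\<And>i. i < n \<Longrightarrow> b i \<ge> 0"
    using psd_mat_spectral[OF G] by blast
  \<comment> \<open>Under the assumption to be refuted, \<open>I\<close> has at least
    \<open>j\<close> elements and \<open>K\<close> at most \<open>j - 1\<close>.
    \<open>eig_desc\<close> counts from 1 and list positions from 0, hence the index
    \<open>j - 1\<close>.\<close>
  define I where "I = {i. i < n \<and> c \<le> a i}"
  define K where "K = {i. i < n \<and> c \<le> b i}"
  have jn: "j - 1 < n" using j by auto
  have "j - 1 < card I"
    using rev_sort_nth_ge(1)[of "j - 1" "map a [0..<n]"] jn
    unfolding I_def c_def eig_desc_spectral[OF U Heq] by (simp cong: conj_cong)
  moreover have "card K \<le> j - 1"
    using rev_sort_nth_ge(2)[of "j - 1" "map b [0..<n]" c] jn contr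
    unfolding K_def c_def[symmetric] eig_desc_spectral[OF V Geq] by (simp cong: conj_cong)
  ultimately have card: "card K < card I" by simp
  \<comment> \<open>Otherwise every index lies in \<open>K\<close>, since no \<open>b i\<close> is
    negative. Positivity of \<open>c\<close> is what allows the contraction bound to be multiplied
    by \<open>c\<close>, and it excludes \<open>y = 0\<close> at the end.\<close>
  have cpos: "c > 0"
  proof (rule ccontr)
    assume "\<not> c > 0"
    then have "K = {..<n}" using b by (force simp: K_def)
    then have "card K = n" by simp
    then show False using \<open>card K \<le> j - 1\<close> jn by simp
  qed
  \<comment> \<open>Takes the coordinates of a vector in the eigenbasis of \<open>H\<close> to those
    of its image under \<open>W\<close> in the eigenbasis of \<open>G\<close>. The vector
    \<open>x\<close> is supported on \<open>I\<close>, where the eigenvalues of \<open>H\<close> are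
    at least \<open>c\<close>, and its image avoids \<open>K\<close>, so only eigenvalues of
    \<open>G\<close> below \<open>c\<close> contribute.\<close>
  define M where "M = mat_adjoint V * W * U"
  have M: "M \<in> carrier_mat n n" using V W U by (simp add: M_def)
  obtain x where x: "x \<in> carrier_vec n" "x \<noteq> 0\<^sub>v n"
    and xI: "\<And>i. i < n \<Longrightarrow> i \<notin> I \<Longrightarrow> x $ i = 0" and xK: "\<And>k. k \<in> K \<Longrightarrow> (M *\<^sub>v x) $ k = 0"
    using exists_nonzero_vec_vanishing[OF M _ _ card] by (auto simp: I_def K_def)
  define v where "v = U *\<^sub>v x"
  have v: "v \<in> carrier_vec n" using U x by (simp add: v_def)
  define y where "y = mat_adjoint V *\<^sub>v (W *\<^sub>v v)"
  have y: "y \<in> carrier_vec n" using V W v by (simp add: y_def)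
  have Mx: "M *\<^sub>v x = y" using V W U x by (simp add: M_def y_def v_def square_assoc_vec)
  have "nsq y = nsq (W *\<^sub>v v)"
    unfolding y_def using V W v unitary_mat_right_inverse[OF V] by (intro nsq_unitary) auto
  also have "\<dots> \<le> nsq v" using W v by simp
  also have "nsq v = nsq x" unfolding v_def using U x by (intro nsq_unitary) auto
  finally have yx: "nsq y \<le> nsq x" .
  have "c * nsq x = (\<Sum>i<n. c * (cmod (x $ i))\<^sup>2)"
    using x by (simp add: nsq_sum sum_distrib_left)
  also have "\<dots> \<le> (\<Sum>i<n. a i * (cmod (x $ i))\<^sup>2)"
  proof (rule sum_mono)
    fix i assume "i \<in> {..<n}"
    then show "c * (cmod (x $ i))\<^sup>2 \<le> a i * (cmod (x $ i))\<^sup>2"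
      using xI[of i] by (cases "i \<in> I") (auto simp: I_def intro!: mult_right_mono)
  qed
  also have "\<dots> = qform H v"
    using qform_spectral[OF U(1) v, of a] U x by (simp add: Heq v_def square_cancel_vec[OF U(2)])
  also have "\<dots> \<le> qform G (W *\<^sub>v v)" using le v by simp
  also have "\<dots> = (\<Sum>i<n. b i * (cmod (y $ i))\<^sup>2)"
    unfolding Geq y_def using V W v by (intro qform_spectral) auto
  finally have lower: "c * nsq x \<le> (\<Sum>i<n. b i * (cmod (y $ i))\<^sup>2)" .
  have le_term: "b i * (cmod (y $ i))\<^sup>2 \<le> c * (cmod (y $ i))\<^sup>2" if "i < n" for i
    using xK[of i] that unfolding Mx by (cases "i \<in> K") (auto simp: K_def intro!: mult_right_mono)
  have pos: "c * nsq x > 0" using cpos nsq_pos[OF x] by simp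
  \<comment> \<open>A nonzero coordinate of \<open>y\<close> lies outside \<open>K\<close>, where
    \<open>b k < c\<close>. If all coordinates vanished, the form of \<open>G\<close> would be 0,
    against \<open>lower\<close> and \<open>pos\<close>.\<close>
  have "\<exists>k<n. b k * (cmod (y $ k))\<^sup>2 < c * (cmod (y $ k))\<^sup>2"
  proof (rule ccontr)
    assume *: "\<not> ?thesis"
    have "y $ k = 0" if "k < n" for k
    proof (rule ccontr)
      assume "y $ k \<noteq> 0"
      then have "k \<notin> K" using xK[of k] Mx by auto
      then have "b k < c" using that by (auto simp: K_def)
      then show False using * that \<open>y $ k \<noteq> 0\<close> by auto
    qed
    then have "(\<Sum>i<n. b i * (cmod (y $ i))\<^sup>2) = 0" by simp
    then show False using lower pos by simp
  qed
  then have "(\<Sum>i<n. b i * (cmod (y $ i))\<^sup>2) < (\<Sum>i<n. c * (cmod (y $ i))\<^sup>2)"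
    using le_term by (intro sum_strict_mono_ex1) auto
  also have "\<dots> = c * nsq y" using y by (simp add: nsq_sum sum_distrib_left)
  also have "\<dots> \<le> c * nsq x" using yx cpos by (intro mult_left_mono) auto
  finally show False using lower by simp
qed

theorem eig_desc_mat_abs_minus_gmean_le:
  assumes A: "A \<in> carrier_mat n n" and B: "B \<in> carrier_mat n n" and X: "X \<in> carrier_mat n n"
    and ppt: "ppt A B X" and t: "0 \<le> t" "t \<le> 1" and j: "j \<in> {1..n}"
  shows "eig_desc j (2 \<cdot>\<^sub>m mat_abs X - gmean t A B) \<le> eig_desc j (gmean (1 - t) A B)"
proof -
  have X': "mat_adjoint X \<in> carrier_mat n n" using X by simp
  have psd1: "psd_mat (four_block_mat A (mat_adjoint X) X B)"
    and psd2: "psd_mat (four_block_mat A (mat_adjoint (mat_adjoint X)) (mat_adjoint X) B)"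
    using ppt by (simp_all add: ppt_def)
  note psd = psd_block_diagonal[OF A B X psd1]
  have t': "0 \<le> 1 - t" "1 - t \<le> 1" using t by auto
  \<comment> \<open>The form of the partial transpose with its two vectors exchanged has the same
    cross term, with \<open>A\<close> and \<open>B\<close> swapped. This is the hypothesis behind
    the end point \<open>t = 1\<close>.\<close>
  have flip: "0 \<le> qform B v + 2 * Re ((X *\<^sub>v v) \<bullet>c w) + qform A w"
    if v: "v \<in> carrier_vec n" and w: "w \<in> carrier_vec n" for v w
  proof -
    have "(mat_adjoint X *\<^sub>v w) \<bullet>c v = cnj ((X *\<^sub>v v) \<bullet>c w)"
      using X v w cscalar_prod_adjoint[OF X v w] by (simp add: cscalar_prod_commute[of v n])
    then show ?thesis using psd_block_qform[OF A B X' psd2 w v] by simp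
  qed
  obtain W where W: "W \<in> carrier_mat n n" "\<And>v. v \<in> carrier_vec n \<Longrightarrow> nsq (W *\<^sub>v v) \<le> nsq v"
    and absc: "mat_abs X \<in> carrier_mat n n" and absp: "psd_mat (mat_abs X)"
    and abs: "\<And>v. v \<in> carrier_vec n \<Longrightarrow> qform (mat_abs X) v = Re ((X *\<^sub>v v) \<bullet>c (W *\<^sub>v v))"
    using mat_abs_polar[OF X] by blast
  note Gc = gmean_carrier[OF A B] and Gp = gmean_psd[OF A psd(1) B psd(2)]
  show ?thesis
  proof (rule eig_desc_le[OF _ _ Gc Gp[OF t'] W _ j])
    show "2 \<cdot>\<^sub>m mat_abs X - gmean t A B \<in> carrier_mat n n" by (rule minus_carrier_mat[OF Gc])
    show "mat_adjoint (2 \<cdot>\<^sub>m mat_abs X - gmean t A B) = 2 \<cdot>\<^sub>m mat_abs X - gmean t A B"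
      using absc absp Gc[of t] Gp[OF t]
        by (simp add: mat_adjoint_minus[of _ n n] mat_adjoint_smult psd_mat_iff)
    fix v :: "complex vec" assume v: "v \<in> carrier_vec n"
    have "qform (2 \<cdot>\<^sub>m mat_abs X - gmean t A B) v = 2 * Re ((X *\<^sub>v v) \<bullet>c (W *\<^sub>v v)) - qform (gmean t A B) v"
      using qform_minus[of "2 \<cdot>\<^sub>m mat_abs X" "gmean t A B" v] qform_smult[OF absc v, of 2] absc Gc v
      by (simp add: abs)
    also have "\<dots> \<le> qform (gmean (1 - t) A B) (W *\<^sub>v v)"
      using ppt_gmean[OF A psd(1) B psd(2) X psd_block_qform[OF A B X psd1] flip t v, of "W *\<^sub>v v"] W v by simp
    finally show "qform (2 \<cdot>\<^sub>m mat_abs X - gmean t A B) v \<le> qform (gmean (1 - t) A B) (W *\<^sub>v v)" .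
  qed
qed

end

theorem corollary2p2:
  fixes A B X :: "complex mat" and n :: nat and t :: real
  assumes "A \<in> carrier_mat n n" and "B \<in> carrier_mat n n" and "X \<in> carrier_mat n n"
    and "ppt A B X"
    and "0 \<le> t" and "t \<le> 1"
  shows "\<forall>j \<in> {1..n}.
    eig_desc j (2 \<cdot>\<^sub>m mat_abs X - gmean t A B) \<le> eig_desc j (gmean (1 - t) A B) \<and>
    eig_desc j (2 \<cdot>\<^sub>m mat_abs (mat_adjoint X) - gmean (1 - t) A B) \<le> eig_desc j (gmean t A B)"
proof -
  \<comment> \<open>Replacing \<open>X\<close> by its adjoint interchanges the two block conditions;
    \<open>1 - (1 - t) = t\<close> then gives the weight on the right-hand side.\<close>
  have "ppt A B (mat_adjoint X)"
    using assms(4) by (simp add: ppt_def)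
  then show ?thesis
    using eig_desc_mat_abs_minus_gmean_le[OF assms(1-6)]
      eig_desc_mat_abs_minus_gmean_le[OF assms(1,2) mat_adjoint_carrier[OF assms(3)], of "1 - t"] assms(5,6)
    by simp
qed

end
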